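(* Let $(N,g_N,\omega_1,\omega_2,\omega_3)$ be the instanton corrected hyperkähler manifold associated to the resolved conifold (as defined in the context). With respect to the local frame $(\beta^\vee,\beta,\delta)$ of $\Gamma$, its metric has the explicit form $$\begin{aligned} g_N=&\Big(-\frac1{2\pi}\log\Big|\frac{1-e^{2\pi it}}{e^{2\pi it}}\Big|+\sum_{n\in\mathbb{Z}}V_n^{\mathrm{inst}}\Big)|dt|^2+\frac1{4\pi^2}\Big(-\frac1{2\pi}\log\Big|\frac{1-e^{2\pi it}}{e^{2\pi it}}\Big|+\sum_{n\in\mathbb{Z}}V_n^{\mathrm{inst}}\Big)^{-1}\\ &\cdot\Big|d\theta_{\beta^\vee}-\frac1{2\pi i}\Big(\log(1-e^{2\pi it})-\log(e^{2\pi it})\Big)d\theta_\beta+\sum_{n\in\mathbb{Z}}\Big(2\pi A_n^{\mathrm{inst}}-iV_n^{\mathrm{inst}}d\theta_\beta\Big)\Big|^2.\end{aligned}$$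
   Context: **Base, charge lattice, central charge.** $M:=\{t\in\mathbb{C}^\times : |\mathrm{Re}(t)|<\tfrac12,\ 2\mathrm{Re}(e^{2\pi i t})\neq1\}$. Let $M_0=M\setminus i\mathbb{R}_{\le0}$. $\Gamma\to M$ is the local system of rank 3 lattices trivialized over $M_0$ by $(\delta,\beta,\beta^\vee)$, where $\delta,\beta$ are global sections and the flat continuation of $\beta^\vee$ counterclockwise across $i\mathbb{R}_{\le0}$ is $\beta^\vee+\beta$. It carries the skew pairing with $\langle\delta,\cdot\rangle=0$, $\langle\beta^\vee,\beta\rangle=1$. Put $\Gamma_f=\mathbb{Z}\delta$. The central charge $Z$ (a holomorphic section of $\Gamma^*\otimes\mathbb{C}$) is, over $M_0$ with principal branches, $$Z_\delta=1,\quad Z_\beta=t,\quad Z_{\beta^\vee}=-\tfrac{1}{(2\pi i)^2}\Big(\tfrac12(\log e^{2\pi it})^2+\mathrm{Li}_2(e^{2\pi it})\Big),$$ and $\tau=\frac{dZ_{\beta^\vee}}{dZ_\beta}=\frac{1}{2\pi i}\big(\log(1-e^{2\pi it})-\log(e^{2\pi it})\big)$. The logarithms in the claim are principal over $M_0$; near points over $i\mathbb{R}_{<0}$ one uses a local flat continuation of $\beta^\vee$ and the corresponding analytic continuation of $\tau$. **BPS indices.** $\Omega(\gamma)=1$ if $\gamma=\pm\beta+n\delta$ ($n\in\mathbb{Z}$), $\Omega(k\delta)=-2$ for $k\in\mathbb{Z}\setminus\{0\}$, and $\Omega(\gamma)=0$ otherwise. **Torus bundle and forms.** Fix a homomorphism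 $\theta_f:\Gamma_f\to\mathbb{R}/2\pi\mathbb{Z}$. The bundle $\pi:\mathcal N(\theta_f)\to M$ has fiber over $p$ the set of homomorphisms $\theta:\Gamma_p\to\mathbb{R}/2\pi\mathbb{Z}$ with $\theta|_{\Gamma_f}=\theta_f$; $\theta_\gamma$ denotes evaluation at $\gamma$. Pullbacks by $\pi$ are omitted. For $\gamma$ with $Z_\gamma\neq0$ define, with $K_\nu$ modified Bessel functions of the second kind, $$V_\gamma^{\mathrm{inst}}=\frac1{2\pi}\sum_{m>0}e^{im\theta_\gamma}K_0(2\pi m|Z_\gamma|),\quad A_\gamma^{\mathrm{inst}}=-\frac1{4\pi}\sum_{m>0}e^{im\theta_\gamma}|Z_\gamma|K_1(2\pi m|Z_\gamma|)\Big(\frac{dZ_\gamma}{Z_\gamma}-\frac{d\overline Z_\gamma}{\overline Z_\gamma}\Big).$$ Define real two-forms on $\mathcal N(\theta_f)$ by $$\omega_1+i\omega_2=-\frac1{2\pi}\langle dZ\wedge d\theta\rangle+\sum_\gamma\Omega(\gamma)\Big(dZ_\gamma\wedge A^{\mathrm{inst}}_\gamma+\frac{i}{2\pi}V^{\mathrm{inst}}_\gamma d\theta_\gamma\wedge dZ_\gamma\Big),$$ $$\omega_3=\frac14\langle dZ\wedge d\overline Z\rangle-\frac1{8\pi^2}\langle d\theta\wedge d\theta\rangle+\sum_\gamma\Omega(\gamma)\Big(\frac i2V^{\mathrm{inst}}_\gamma dZ_\gamma\wedge d\overline Z_\gamma+\frac1{2\pi}d\theta_\gamma\wedge A^{\mathrm{inst}}_\gamma\Big),$$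 where $\langle dX\wedge dY\rangle=dX_{\beta^\vee}\wedge dY_\beta-dX_\beta\wedge dY_{\beta^\vee}$, and sums run over $\gamma$ with $\Omega(\gamma)\ne0$ (the $k\delta$ terms vanish as $dZ_\delta=d\theta_\delta=0$). Let $g_{sK}=\mathrm{Im}(\tau)|dt|^2$ and $T=\pi^*g_{sK}+\sum_\gamma\Omega(\gamma)V_\gamma^{\mathrm{inst}}\pi^*|dZ_\gamma|^2$. $N\subset\mathcal N(\theta_f)$ is the open subset where $T$ is horizontally non-degenerate (non-degenerate on the normal bundle of the fibers of $\pi$). On $N$ the forms $\omega_\alpha$ are the Kähler forms of a (possibly indefinite) hyperkähler structure $(g_N,I_1,I_2,I_3)$ with $I_1I_2=I_3$, $\omega_\alpha(X,Y)=g_N(I_\alpha X,Y)$, which they determine; this is the instanton corrected hyperkähler manifold associated to the resolved conifold. **Notation.** For $n\in\mathbb{Z}$, $$V_n^{\mathrm{inst}}:=V^{\mathrm{inst}}_{\beta-n\delta}+V^{\mathrm{inst}}_{-\beta+n\delta}=\frac1{2\pi}\sum_{m\in\mathbb{Z}\setminus\{0\}}e^{im\theta_{\beta-n\delta}}K_0(2\pi|m||t-n|),$$ $$A_n^{\mathrm{inst}}:=A^{\mathrm{inst}}_{\beta-n\delta}-A^{\mathrm{inst}}_{-\beta+n\delta}=-\frac1{4\pi}\Big(\sum_{m\in\mathbb{Z}\setminus\{0\}}\mathrm{sign}(m)e^{im\theta_{\beta-n\delta}}|t-n|K_1(2\pi|m||t-n|)\Big)\Big(\frac{dt}{t-n}-\frac{d\overline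 t}{\overline t-n}\Big).$$ For a complex one-form $W$, $|W|^2$ is the symmetric tensor $W\overline W=(\mathrm{Re}\,W)^2+(\mathrm{Im}\,W)^2$. *)

theory Defs
  imports "HOL-Complex_Analysis.Complex_Analysis"
begin

section \<open>Special functions\<close>

text \<open>The integral representation of the modified Bessel function of the second kind,
  valid for positive arguments.\<close>

definition besselK :: "real \<Rightarrow> real \<Rightarrow> real" where
  "besselK \<nu> x = integral {0..} (\<lambda>s. exp (- x * cosh s) * cosh (\<nu> * s))"

text \<open>The principal branch of the dilogarithm, with branch cut \<open>[1, \<infinity>)\<close>. On the cut, the library
  convention \<open>Im (Ln x) = \<pi>\<close> for negative \<open>x\<close> selects the limit from the lower half plane.\<close>

definition dilog :: "complex \<Rightarrow> complex" where
  "dilog z = - integral {0..1} (\<lambda>s. Ln (1 - complex_of_real s * z) / complex_of_real s)"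


section \<open>The group of angles\<close>

definition angle_rel :: "real \<Rightarrow> real \<Rightarrow> bool" where
  "angle_rel x y \<longleftrightarrow> (\<exists>k::int. x - y = 2 * pi * of_int k)"

lemma angle_relI: "x - y = 2 * pi * of_int k \<Longrightarrow> angle_rel x y"
  by (auto simp: angle_rel_def)

quotient_type angle = real / angle_rel
proof (rule equivpI)
  show "reflp angle_rel"
    by (rule reflpI) (rule angle_relI[where k = 0], simp)
  show "symp angle_rel"
  proof (rule sympI)
    fix x y assume "angle_rel x y"
    then obtain k :: int where "x - y = 2 * pi * of_int k" by (auto simp: angle_rel_def)
    then show "angle_rel y x" by (intro angle_relI[where k = "- k"]) (simp add: algebra_simps)
  qed
  show "transp angle_rel"
  proof (rule transpI)
    fix x y z assume "angle_rel x y" "angle_rel y z"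
    then obtain k l :: int where "x - y = 2 * pi * of_int k" "y - z = 2 * pi * of_int l"
      by (auto simp: angle_rel_def)
    then show "angle_rel x z"
      by (intro angle_relI[where k = "k + l"]) (simp add: algebra_simps)
  qed
qed

instantiation angle :: ab_group_add
begin

lift_definition zero_angle :: angle is 0 .

lift_definition plus_angle :: "angle \<Rightarrow> angle \<Rightarrow> angle" is "(+)"
proof -
  fix x y x' y' assume "angle_rel x y" "angle_rel x' y'"
  then obtain k l :: int where "x - y = 2 * pi * of_int k" "x' - y' = 2 * pi * of_int l"
    by (auto simp: angle_rel_def)
  then show "angle_rel (x + x') (y + y')"
    by (intro angle_relI[where k = "k + l"]) (simp add: algebra_simps)
qed

lift_definition uminus_angle :: "angle \<Rightarrow> angle" is uminus
proof -
  fix x y assume "angle_rel x y"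
  then obtain k :: int where "x - y = 2 * pi * of_int k" by (auto simp: angle_rel_def)
  then show "angle_rel (- x) (- y)" by (intro angle_relI[where k = "- k"]) (simp add: algebra_simps)
qed

lift_definition minus_angle :: "angle \<Rightarrow> angle \<Rightarrow> angle" is "(-)"
proof -
  fix x y x' y' assume "angle_rel x y" "angle_rel x' y'"
  then obtain k l :: int where "x - y = 2 * pi * of_int k" "x' - y' = 2 * pi * of_int l"
    by (auto simp: angle_rel_def)
  then show "angle_rel (x - x') (y - y')"
    by (intro angle_relI[where k = "k - l"]) (simp add: algebra_simps)
qed

instance
  by standard (transfer, rule angle_relI[where k = 0], simp)+

end

lift_definition angle_of :: "real \<Rightarrow> angle" is "\<lambda>x. x" .

lift_definition cis_mult :: "nat \<Rightarrow> angle \<Rightarrow> complex" is "\<lambda>m x. cis (real m * x)"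
proof -
  fix m x y assume "angle_rel x y"
  then obtain k :: int where k: "x - y = 2 * pi * of_int k" by (auto simp: angle_rel_def)
  have "real m * x = real m * y + 2 * pi * of_int (int m * k)"
    using k by (simp add: algebra_simps flip: distrib_left)
  then show "cis (real m * x) = cis (real m * y)"
    by (simp add: cis_multiple_2pi flip: cis_mult)
qed


section \<open>Base, charge lattice, central charge\<close>

definition base :: "complex set" where
  "base = {t. t \<noteq> 0 \<and> \<bar>Re t\<bar> < 1/2 \<and> 2 * Re (exp (2 * pi * \<i> * t)) \<noteq> 1}"

definition cut :: "complex set" where
  "cut = {t. Re t = 0 \<and> Im t \<le> 0}"

text \<open>The charge \<open>n\<delta> + k\<beta> + l\<beta>\<^sup>\<or>\<close> in a fibre of the local system is the triple \<open>(n, k, l)\<close>. Off the cut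
  this refers to the given trivialization; the fibre over a point of the cut is identified with
  the neighbouring fibres on the side \<open>Re t < 0\<close> by flat continuation. This is the side from which
  the library values of \<open>Ln (1 - e\<^sup>2\<^sup>\<pi>\<^sup>i\<^sup>t)\<close> and of \<^const>\<open>dilog\<close> on the cut are limits, so all
  principal branches below are continuous from that side.\<close>

type_synonym charge = "int \<times> int \<times> int"

text \<open>The germ at \<open>t\<^sub>0\<close> of the flat section through a charge over \<open>t\<^sub>0\<close>. Going counterclockwise
  around the origin, the negative imaginary axis is crossed from \<open>Re t < 0\<close> to \<open>Re t > 0\<close>.\<close>

definition flat_germ :: "complex \<Rightarrow> charge \<Rightarrow> complex \<Rightarrow> charge" where
  "flat_germ t0 = (\<lambda>(n, k, l) t. if t0 \<in> cut \<and> Re t > 0 then (n, k + l, l) else (n, k, l))"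

definition flat_section :: "complex set \<Rightarrow> (complex \<Rightarrow> charge) \<Rightarrow> bool" where
  "flat_section U s \<longleftrightarrow> (\<forall>t0\<in>U. \<forall>\<^sub>F t in nhds t0. s t = flat_germ t0 (s t0) t)"

definition Z_dual :: "complex \<Rightarrow> complex" where
  "Z_dual t = - 1 / (2 * pi * \<i>)\<^sup>2 *
     (1/2 * (Ln (exp (2 * pi * \<i> * t)))\<^sup>2 + dilog (exp (2 * pi * \<i> * t)))"

definition Zc :: "complex \<Rightarrow> charge \<Rightarrow> complex" where
  "Zc t = (\<lambda>(n, k, l). of_int n + of_int k * t + of_int l * Z_dual t)"

text \<open>\<open>dZ\<^sub>\<gamma> = Zc' t \<gamma> dt\<close>, the derivative being taken along the flat extension of \<open>\<gamma>\<close>.\<close>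

definition Zc' :: "complex \<Rightarrow> charge \<Rightarrow> complex" where
  "Zc' t \<gamma> = deriv (\<lambda>s. Zc s (flat_germ t \<gamma> s)) t"

definition tau :: "complex \<Rightarrow> complex" where
  "tau t = Zc' t (0, 0, 1) / Zc' t (0, 1, 0)"

definition bps :: "charge \<Rightarrow> int" where
  "bps = (\<lambda>(n, k, l). if l = 0 \<and> \<bar>k\<bar> = 1 then 1
                   else if l = 0 \<and> k = 0 \<and> n \<noteq> 0 then - 2
                   else 0)"


section \<open>The torus bundle and its forms\<close>

text \<open>\<open>\<theta>\<^sub>f\<close> is given by \<open>n \<mapsto> \<theta>\<^sub>f (n\<delta>)\<close>.\<close>

type_synonym point = "complex \<times> (charge \<Rightarrow> angle)"

definition torus_bundle :: "(int \<Rightarrow> angle) \<Rightarrow> point set" where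
  "torus_bundle \<theta>f =
     {(t, \<theta>). t \<in> base \<and> Modules.additive \<theta> \<and> (\<forall>n. \<theta> (n, 0, 0) = \<theta>f n)}"

text \<open>Flatness of the local system makes \<open>dt\<close>, \<open>d\<theta>\<^sub>\<beta>\<close>, \<open>d\<theta>\<^sub>\<beta>\<^sub>\<or>\<close> a coframe, where \<open>\<beta>\<^sup>\<or>\<close> is the flat
  extension of \<open>(0, 0, 1)\<close> from the given point. A tangent vector is the triple of its values.\<close>

type_synonym tangent = "complex \<times> real \<times> real"

definition d\<theta> :: "charge \<Rightarrow> tangent \<Rightarrow> real" where
  "d\<theta> = (\<lambda>(n, k, l) (v, a, b). of_int k * a + of_int l * b)"

definition dt :: "tangent \<Rightarrow> complex" where
  "dt X = fst X"

definition dZ :: "point \<Rightarrow> charge \<Rightarrow> tangent \<Rightarrow> complex" where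
  "dZ p \<gamma> X = Zc' (fst p) \<gamma> * dt X"

definition wedge :: "(tangent \<Rightarrow> complex) \<Rightarrow> (tangent \<Rightarrow> complex) \<Rightarrow> tangent \<Rightarrow> tangent \<Rightarrow> complex" where
  "wedge a b X Y = a X * b Y - a Y * b X"

text \<open>The pairing form \<open>\<langle>dX \<and> dY\<rangle>\<close> of two families of one-forms indexed by charges.\<close>

definition pair_wedge ::
  "(charge \<Rightarrow> tangent \<Rightarrow> complex) \<Rightarrow> (charge \<Rightarrow> tangent \<Rightarrow> complex) \<Rightarrow> tangent \<Rightarrow> tangent \<Rightarrow> complex" where
  "pair_wedge a b X Y =
     wedge (a (0, 0, 1)) (b (0, 1, 0)) X Y - wedge (a (0, 1, 0)) (b (0, 0, 1)) X Y"

text \<open>\<open>|W|\<^sup>2 = (Re W)\<^sup>2 + (Im W)\<^sup>2\<close> as a symmetric bilinear form.\<close>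

definition abs_sq :: "(tangent \<Rightarrow> complex) \<Rightarrow> tangent \<Rightarrow> tangent \<Rightarrow> real" where
  "abs_sq W X Y = Re (W X) * Re (W Y) + Im (W X) * Im (W Y)"

definition V_inst :: "charge \<Rightarrow> point \<Rightarrow> complex" where
  "V_inst \<gamma> = (\<lambda>(t, \<theta>). 1 / (2 * pi) *
     (\<Sum>\<^sub>\<infinity>m\<in>{0<..}. cis_mult m (\<theta> \<gamma>) * besselK 0 (2 * pi * real m * cmod (Zc t \<gamma>))))"

definition A_inst :: "charge \<Rightarrow> point \<Rightarrow> tangent \<Rightarrow> complex" where
  "A_inst \<gamma> = (\<lambda>(t, \<theta>) X. - 1 / (4 * pi) *
     (\<Sum>\<^sub>\<infinity>m\<in>{0<..}. cis_mult m (\<theta> \<gamma>) * cmod (Zc t \<gamma>) *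
        besselK 1 (2 * pi * real m * cmod (Zc t \<gamma>)) *
        (dZ (t, \<theta>) \<gamma> X / Zc t \<gamma> - cnj (dZ (t, \<theta>) \<gamma> X) / cnj (Zc t \<gamma>))))"

definition omega12 :: "point \<Rightarrow> tangent \<Rightarrow> tangent \<Rightarrow> complex" where
  "omega12 p X Y =
     - 1 / (2 * pi) * pair_wedge (dZ p) (\<lambda>\<gamma> X. of_real (d\<theta> \<gamma> X)) X Y +
     (\<Sum>\<^sub>\<infinity>\<gamma>\<in>{\<gamma>. bps \<gamma> \<noteq> 0}. of_int (bps \<gamma>) *
        (wedge (dZ p \<gamma>) (A_inst \<gamma> p) X Y +
         \<i> / (2 * pi) * V_inst \<gamma> p * wedge (\<lambda>X. of_real (d\<theta> \<gamma> X)) (dZ p \<gamma>) X Y))"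

definition omega1 :: "point \<Rightarrow> tangent \<Rightarrow> tangent \<Rightarrow> real" where
  "omega1 p X Y = Re (omega12 p X Y)"

definition omega2 :: "point \<Rightarrow> tangent \<Rightarrow> tangent \<Rightarrow> real" where
  "omega2 p X Y = Im (omega12 p X Y)"

text \<open>The sum below is real, because the contributions of \<open>\<gamma>\<close> and \<open>-\<gamma>\<close> are complex conjugate.\<close>

definition omega3 :: "point \<Rightarrow> tangent \<Rightarrow> tangent \<Rightarrow> real" where
  "omega3 p X Y = Re (
     1/4 * pair_wedge (dZ p) (\<lambda>\<gamma> X. cnj (dZ p \<gamma> X)) X Y -
     1 / (8 * pi\<^sup>2) * pair_wedge (\<lambda>\<gamma> X. of_real (d\<theta> \<gamma> X)) (\<lambda>\<gamma> X. of_real (d\<theta> \<gamma> X)) X Y +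
     (\<Sum>\<^sub>\<infinity>\<gamma>\<in>{\<gamma>. bps \<gamma> \<noteq> 0}. of_int (bps \<gamma>) *
        (\<i> / 2 * V_inst \<gamma> p * wedge (dZ p \<gamma>) (\<lambda>X. cnj (dZ p \<gamma> X)) X Y +
         1 / (2 * pi) * wedge (\<lambda>X. of_real (d\<theta> \<gamma> X)) (A_inst \<gamma> p) X Y)))"

text \<open>The sum is again real.\<close>

definition T_tensor :: "point \<Rightarrow> tangent \<Rightarrow> tangent \<Rightarrow> real" where
  "T_tensor p X Y = Im (tau (fst p)) * abs_sq dt X Y +
     Re (\<Sum>\<^sub>\<infinity>\<gamma>\<in>{\<gamma>. bps \<gamma> \<noteq> 0}. of_int (bps \<gamma>) * V_inst \<gamma> p * abs_sq (dZ p \<gamma>) X Y)"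

text \<open>\<open>T\<close> annihilates the kernel of \<open>d\<pi> = dt\<close>; non-degeneracy on the quotient by that kernel.\<close>

definition horizontally_nondegenerate :: "(tangent \<Rightarrow> tangent \<Rightarrow> real) \<Rightarrow> bool" where
  "horizontally_nondegenerate T \<longleftrightarrow> (\<forall>X. (\<forall>Y. T X Y = 0) \<longrightarrow> dt X = 0)"

definition N_space :: "(int \<Rightarrow> angle) \<Rightarrow> point set" where
  "N_space \<theta>f = {p \<in> torus_bundle \<theta>f. horizontally_nondegenerate (T_tensor p)}"


section \<open>Smooth structure of the torus bundle\<close>

text \<open>A flat continuation \<open>\<beta>\<^sup>\<or> + k\<beta>\<close> of \<open>\<beta>\<^sup>\<or>\<close> over an open set \<open>U\<close>, given by the integer function \<open>k\<close>.\<close>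

definition flat_frame :: "complex set \<Rightarrow> (complex \<Rightarrow> int) \<Rightarrow> bool" where
  "flat_frame U k \<longleftrightarrow> open U \<and> U \<subseteq> base \<and> flat_section U (\<lambda>t. (0, k t, 1))"

text \<open>Inverse local coordinates of the frame: \<open>(t, y, z)\<close> is sent to the point over \<open>t\<close> with
  \<open>\<theta>\<^sub>\<beta> = y\<close> and \<open>\<theta> = z\<close> on \<open>\<beta>\<^sup>\<or> + k\<beta>\<close>. Every point over \<open>U\<close> is reached, and the map is a local
  diffeomorphism \<open>U \<times> \<real> \<times> \<real> \<rightarrow> \<pi>\<^sup>-\<^sup>1 U\<close>, since only the passage from reals to angles is not injective.\<close>

definition chart :: "(int \<Rightarrow> angle) \<Rightarrow> (complex \<Rightarrow> int) \<Rightarrow> tangent \<Rightarrow> point" where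
  "chart \<theta>f k = (\<lambda>(t, y, z).
     (t, \<lambda>(n, j, l). \<theta>f n + angle_of (of_int j * y + of_int l * (z - of_int (k t) * y))))"

definition chart_dom :: "(int \<Rightarrow> angle) \<Rightarrow> point set \<Rightarrow> complex set \<Rightarrow> (complex \<Rightarrow> int) \<Rightarrow> tangent set" where
  "chart_dom \<theta>f S U k = {x. fst x \<in> U \<and> chart \<theta>f k x \<in> S}"

text \<open>The differential of the chart, from coordinate vectors to values of the coframe above, and
  its inverse.\<close>

definition d_chart :: "(complex \<Rightarrow> int) \<Rightarrow> tangent \<Rightarrow> tangent \<Rightarrow> tangent" where
  "d_chart k x = (\<lambda>(v, a, c). (v, a, c - of_int (k (fst x)) * a))"

definition d_chart_inv :: "(complex \<Rightarrow> int) \<Rightarrow> tangent \<Rightarrow> tangent \<Rightarrow> tangent" where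
  "d_chart_inv k x = (\<lambda>(v, a, b). (v, a, b + of_int (k (fst x)) * a))"

definition pull_form ::
  "(int \<Rightarrow> angle) \<Rightarrow> (complex \<Rightarrow> int) \<Rightarrow> (point \<Rightarrow> tangent \<Rightarrow> tangent \<Rightarrow> real) \<Rightarrow>
   tangent \<Rightarrow> tangent \<Rightarrow> tangent \<Rightarrow> real" where
  "pull_form \<theta>f k w x X Y = w (chart \<theta>f k x) (d_chart k x X) (d_chart k x Y)"

definition pull_endo ::
  "(int \<Rightarrow> angle) \<Rightarrow> (complex \<Rightarrow> int) \<Rightarrow> (point \<Rightarrow> tangent \<Rightarrow> tangent) \<Rightarrow> tangent \<Rightarrow> tangent \<Rightarrow> tangent" where
  "pull_endo \<theta>f k J x X = d_chart_inv k x (J (chart \<theta>f k x) (d_chart k x X))"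

primrec C_on ::
  "nat \<Rightarrow> ('a::real_normed_vector \<Rightarrow> 'b::real_normed_vector) \<Rightarrow> 'a set \<Rightarrow> bool" where
  "C_on 0 = (\<lambda>f D. continuous_on D f)"
| "C_on (Suc r) = (\<lambda>f D. (\<forall>x\<in>D. f differentiable at x) \<and>
                        (\<forall>v. C_on r (\<lambda>x. frechet_derivative f (at x) v) D))"

definition smooth_form :: "(int \<Rightarrow> angle) \<Rightarrow> point set \<Rightarrow> (point \<Rightarrow> tangent \<Rightarrow> tangent \<Rightarrow> real) \<Rightarrow> bool" where
  "smooth_form \<theta>f S w \<longleftrightarrow> (\<forall>U k. flat_frame U k \<longrightarrow>
     (\<forall>X Y r. C_on r (\<lambda>x. pull_form \<theta>f k w x X Y) (chart_dom \<theta>f S U k)))"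

definition smooth_endo :: "(int \<Rightarrow> angle) \<Rightarrow> point set \<Rightarrow> (point \<Rightarrow> tangent \<Rightarrow> tangent) \<Rightarrow> bool" where
  "smooth_endo \<theta>f S J \<longleftrightarrow> (\<forall>U k. flat_frame U k \<longrightarrow>
     (\<forall>X r. C_on r (\<lambda>x. pull_endo \<theta>f k J x X) (chart_dom \<theta>f S U k)))"

definition closed_form :: "(int \<Rightarrow> angle) \<Rightarrow> point set \<Rightarrow> (point \<Rightarrow> tangent \<Rightarrow> tangent \<Rightarrow> real) \<Rightarrow> bool" where
  "closed_form \<theta>f S w \<longleftrightarrow> (\<forall>U k. flat_frame U k \<longrightarrow>
     (\<forall>x\<in>chart_dom \<theta>f S U k. \<forall>X Y W.
        frechet_derivative (\<lambda>x. pull_form \<theta>f k w x Y W) (at x) X -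
        frechet_derivative (\<lambda>x. pull_form \<theta>f k w x X W) (at x) Y +
        frechet_derivative (\<lambda>x. pull_form \<theta>f k w x X Y) (at x) W = 0))"

text \<open>Vanishing of the Nijenhuis tensor \<open>[JX, JY] - J[JX, Y] - J[X, JY] - [X, Y]\<close>, written out for
  coordinate vector fields \<open>X\<close> and \<open>Y\<close>.\<close>

definition integrable_endo :: "(int \<Rightarrow> angle) \<Rightarrow> point set \<Rightarrow> (point \<Rightarrow> tangent \<Rightarrow> tangent) \<Rightarrow> bool" where
  "integrable_endo \<theta>f S J \<longleftrightarrow> (\<forall>U k. flat_frame U k \<longrightarrow>
     (\<forall>x\<in>chart_dom \<theta>f S U k. \<forall>X Y.
        (let J' = pull_endo \<theta>f k J;
             D = (\<lambda>V X. frechet_derivative (\<lambda>x. J' x X) (at x) V)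
         in D (J' x X) Y - D (J' x Y) X + J' x (D Y X) - J' x (D X Y) = 0)))"


section \<open>Hyperkaehler structures\<close>

definition pseudo_kaehler ::
  "(int \<Rightarrow> angle) \<Rightarrow> point set \<Rightarrow> (point \<Rightarrow> tangent \<Rightarrow> tangent \<Rightarrow> real) \<Rightarrow>
   (point \<Rightarrow> tangent \<Rightarrow> tangent) \<Rightarrow> bool" where
  "pseudo_kaehler \<theta>f S g J \<longleftrightarrow>
     (\<forall>p\<in>S. bilinear (g p) \<and> (\<forall>X Y. g p X Y = g p Y X) \<and>
            (\<forall>X. (\<forall>Y. g p X Y = 0) \<longrightarrow> X = 0) \<and>
            linear (J p) \<and> (\<forall>X. J p (J p X) = - X) \<and>
            (\<forall>X Y. g p (J p X) (J p Y) = g p X Y)) \<and>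
     smooth_form \<theta>f S g \<and> smooth_endo \<theta>f S J \<and> integrable_endo \<theta>f S J \<and>
     closed_form \<theta>f S (\<lambda>p X Y. g p (J p X) Y)"

definition hyperkaehler ::
  "(int \<Rightarrow> angle) \<Rightarrow> point set \<Rightarrow> (point \<Rightarrow> tangent \<Rightarrow> tangent \<Rightarrow> real) \<Rightarrow>
   (point \<Rightarrow> tangent \<Rightarrow> tangent) \<Rightarrow> (point \<Rightarrow> tangent \<Rightarrow> tangent) \<Rightarrow>
   (point \<Rightarrow> tangent \<Rightarrow> tangent) \<Rightarrow> bool" where
  "hyperkaehler \<theta>f S g I1 I2 I3 \<longleftrightarrow>
     pseudo_kaehler \<theta>f S g I1 \<and> pseudo_kaehler \<theta>f S g I2 \<and> pseudo_kaehler \<theta>f S g I3 \<and>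
     (\<forall>p\<in>S. \<forall>X. I1 p (I2 p X) = I3 p X)"

definition instanton_corrected_hyperkaehler ::
  "(int \<Rightarrow> angle) \<Rightarrow> (point \<Rightarrow> tangent \<Rightarrow> tangent \<Rightarrow> real) \<Rightarrow>
   (point \<Rightarrow> tangent \<Rightarrow> tangent) \<Rightarrow> (point \<Rightarrow> tangent \<Rightarrow> tangent) \<Rightarrow>
   (point \<Rightarrow> tangent \<Rightarrow> tangent) \<Rightarrow> bool" where
  "instanton_corrected_hyperkaehler \<theta>f g I1 I2 I3 \<longleftrightarrow>
     hyperkaehler \<theta>f (N_space \<theta>f) g I1 I2 I3 \<and>
     (\<forall>p\<in>N_space \<theta>f. \<forall>X Y.
        omega1 p X Y = g p (I1 p X) Y \<and>
        omega2 p X Y = g p (I2 p X) Y \<and>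
        omega3 p X Y = g p (I3 p X) Y)"


section \<open>Local frames and the data of the explicit metric\<close>

text \<open>A flat continuation \<open>\<beta>\<^sup>\<or> + k\<beta>\<close> of \<open>\<beta>\<^sup>\<or>\<close> over a connected open \<open>U\<close>, and the corresponding analytic
  continuation \<open>L\<close> of \<open>log (1 - e\<^sup>2\<^sup>\<pi>\<^sup>i\<^sup>t)\<close>: both agree with \<open>\<beta>\<^sup>\<or>\<close> and the principal logarithm at some
  point off the cut. No continuation of \<open>log (e\<^sup>2\<^sup>\<pi>\<^sup>i\<^sup>t)\<close> is needed, its principal value being
  holomorphic on \<^const>\<open>base\<close>.\<close>

definition local_frame :: "complex set \<Rightarrow> (complex \<Rightarrow> int) \<Rightarrow> (complex \<Rightarrow> complex) \<Rightarrow> bool" where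
  "local_frame U k L \<longleftrightarrow> flat_frame U k \<and> connected U \<and>
     L holomorphic_on U \<and> (\<forall>t\<in>U. exp (L t) = 1 - exp (2 * pi * \<i> * t)) \<and>
     (\<exists>t1\<in>U - cut. k t1 = 0 \<and> L t1 = Ln (1 - exp (2 * pi * \<i> * t1)))"

text \<open>Over connected open sets away from the cut, the principal frame and logarithm are admissible.\<close>

lemma local_frame_principal:
  assumes "open U" "connected U" "U \<noteq> {}" "U \<subseteq> base - cut"
  shows "local_frame U (\<lambda>_. 0) (\<lambda>t. Ln (1 - exp (2 * pi * \<i> * t)))"
proof -
  have nonpos: "1 - exp (2 * pi * \<i> * t) \<notin> \<real>\<^sub>\<le>\<^sub>0" if "t \<in> U" for t
  proof
    assume *: "1 - exp (2 * pi * \<i> * t) \<in> \<real>\<^sub>\<le>\<^sub>0"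
    have t: "\<bar>Re t\<bar> < 1/2" "t \<notin> cut" using that assms by (auto simp: base_def)
    have re: "1 \<le> exp (- 2 * pi * Im t) * cos (2 * pi * Re t)"
      and im: "sin (2 * pi * Re t) = 0"
      using * by (auto simp: complex_nonpos_Reals_iff Re_exp Im_exp)
    have "\<bar>2 * pi * Re t\<bar> < pi" using t pi_gt_zero by (simp add: abs_mult)
    then have "2 * pi * Re t = 0" using im sin_eq_0_pi[of "2 * pi * Re t"] by linarith
    then have "Re t = 0" by simp
    with re have "1 \<le> exp (- 2 * pi * Im t)" by simp
    then have "Im t \<le> 0" using pi_gt_zero by (simp add: zero_le_mult_iff mult_le_0_iff)
    with \<open>Re t = 0\<close> t show False by (simp add: cut_def)
  qed
  have flat: "flat_frame U (\<lambda>_. 0)"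
    using assms by (auto simp: flat_frame_def flat_section_def flat_germ_def)
  obtain t1 where "t1 \<in> U - cut" using assms by auto
  moreover have "exp (Ln (1 - exp (2 * pi * \<i> * t))) = 1 - exp (2 * pi * \<i> * t)" if "t \<in> U" for t
    using nonpos[OF that] by (intro exp_Ln) auto
  moreover have "(\<lambda>t. Ln (1 - exp (2 * pi * \<i> * t))) holomorphic_on U"
    by (intro holomorphic_intros nonpos)
  ultimately show ?thesis using assms flat unfolding local_frame_def by blast
qed

definition V_n :: "int \<Rightarrow> point \<Rightarrow> complex" where
  "V_n n p = V_inst (- n, 1, 0) p + V_inst (n, - 1, 0) p"

definition A_n :: "int \<Rightarrow> point \<Rightarrow> tangent \<Rightarrow> complex" where
  "A_n n p X = A_inst (- n, 1, 0) p X - A_inst (n, - 1, 0) p X"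

end

theory Submission
  imports Defs
begin

text \<open>
  The metric is determined by linear algebra at a single point, once the three forms are known
  there. With \<open>W\<close> the one-form of the claim and \<open>F\<close> the coefficient of \<open>|dt|\<^sup>2\<close>, one has
  \<open>\<omega>\<^sub>1 + i\<omega>\<^sub>2 = 1/(2\<pi>) dt \<and> W\<close> and \<open>\<omega>\<^sub>3 = i/2 (F dt \<and> dt\<^sup>* + 1/(4\<pi>\<^sup>2 F) W \<and> W\<^sup>*)\<close>, where the star is
  complex conjugation (\<open>omega12_eq\<close>, \<open>omega3_eq\<close>). Because \<open>I\<^sub>3 = I\<^sub>1 I\<^sub>2\<close>, the relation
  \<open>\<omega>\<^sub>1(I\<^sub>2 X, Y) = \<omega>\<^sub>3(X, Y)\<close> holds, and it can be solved for \<open>dt\<close> and \<open>W\<close> on \<open>I\<^sub>2 X\<close> since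
  \<open>(dt, W)\<close> is onto \<open>\<complex>\<^sup>2\<close>. Then \<open>g(X, Y) = g(I\<^sub>2 X, I\<^sub>2 Y) = \<omega>\<^sub>2(X, I\<^sub>2 Y)\<close> is the asserted expression
  (\<open>metric_from_holomorphic_symplectic_pair\<close>). The non-degeneracy that defines \<open>N\<close> says
  exactly that \<open>F \<noteq> 0\<close>, because \<open>T = F |dt|\<^sup>2\<close>.

  Three analytic facts turn the definitions of the forms into these expressions.

  \<^item> The derivative of the magnetic central charge along its flat extension is
    \<open>(log (1 - q) - log q) / (2\<pi>i)\<close> with \<open>q = e\<^sup>2\<^sup>\<pi>\<^sup>i\<^sup>t\<close>, also on the cut (\<open>Zc'_magnetic\<close>). The reflection
    formula \<open>Li\<^sub>2(q) = C - log q log (1 - q) + R(q)\<close>, with \<open>R\<close> holomorphic off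
    \<open>(-\<infinity>, 0]\<close>, moves the discontinuity of the dilogarithm into \<open>log (1 - q)\<close>, where it cancels against the monodromy of
    the lattice (\<open>dilog_reflection\<close>, \<open>log_germ_has_field_derivative\<close>).
  \<^item> Along a local frame the continued logarithm \<open>L\<close> differs from the principal one by
    \<open>2\<pi>i k\<close>, so that the frame \<open>\<beta>\<^sup>\<or> + k\<beta>\<close> with \<open>L\<close> yields the same \<open>W\<close> as \<open>\<beta>\<^sup>\<or>\<close> with the principal
    logarithm (\<open>local_frame_log\<close>).
  \<^item> The instanton sums converge absolutely, since \<open>K\<^sub>0(x)\<close> and \<open>K\<^sub>1(x)\<close> are at most \<open>4/x\<^sup>2\<close> and the
    sum of \<open>|t - n|\<^sup>-\<^sup>2\<close> over the integers is finite. So the sum over BPS charges may be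
    regrouped into the pairs \<open>\<gamma>, -\<gamma>\<close> (\<open>bps_sum_linear\<close>).
\<close>

section \<open>The dilogarithm and its reflection formula\<close>

lemma scaled_not_on_ray:
  fixes w :: complex
  assumes "1 - w \<notin> \<real>\<^sub>\<le>\<^sub>0" "0 \<le> s" "s \<le> 1"
  shows "1 - of_real s * w \<notin> \<real>\<^sub>\<le>\<^sub>0"
proof
  assume "1 - of_real s * w \<in> \<real>\<^sub>\<le>\<^sub>0"
  then have *: "1 \<le> s * Re w" "s * Im w = 0" by (auto simp: complex_nonpos_Reals_iff)
  then have "Im w = 0" by auto
  moreover have "1 \<le> Re w"
    using * assms(2,3) by (smt (verit, best) mult_left_le_one_le mult_nonneg_nonpos)
  ultimately show False using assms(1) by (auto simp: complex_nonpos_Reals_iff)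
qed

lemma plane_without_ray_from_1:
  defines "S \<equiv> {w::complex. 1 - w \<notin> \<real>\<^sub>\<le>\<^sub>0}"
  shows "open S" "starlike S" "0 \<in> S"
proof -
  have "S = (\<lambda>w. 1 - w) -` (- \<real>\<^sub>\<le>\<^sub>0)" by (auto simp: S_def)
  then show "open S" by (auto intro!: open_vimage continuous_intros)
  show "0 \<in> S" by (simp add: S_def)
  moreover have "closed_segment 0 w \<subseteq> S" if "w \<in> S" for w
    using that scaled_not_on_ray by (auto simp: S_def in_segment scaleR_conv_of_real)
  ultimately show "starlike S" unfolding starlike_def by blast
qed

lemma starlike_holomorphic_primitive:
  assumes "f holomorphic_on S" "starlike S" "open S"
  obtains g where "\<And>z. z \<in> S \<Longrightarrow> (g has_field_derivative f z) (at z)"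
proof -
  have "\<exists>g. \<forall>x\<in>S. (g has_field_derivative f x) (at x)"
    by (rule holomorphic_starlike_primitive[where k = "{}"])
       (use assms in \<open>auto simp: holomorphic_on_open field_differentiable_def
          intro: holomorphic_on_imp_continuous_on\<close>)
  then show ?thesis using that by blast
qed

text \<open>The integral defining \<open>Li\<^sub>2(z)\<close> runs along the segment from \<open>0\<close> to \<open>z\<close>, and the plane
  without \<open>[1, \<infinity>)\<close> is star-shaped about \<open>0\<close>. Hence the dilogarithm is, up to sign, a primitive of
  \<open>log (1 - w) / w\<close> with its singularity at \<open>0\<close> removed.\<close>

lemma dilog_has_field_derivative:
  assumes "1 - z \<notin> \<real>\<^sub>\<le>\<^sub>0"
  shows "(dilog has_field_derivative - (if z = 0 then -1 else Ln (1 - z) / z)) (at z)"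
proof -
  define S where "S = {w::complex. 1 - w \<notin> \<real>\<^sub>\<le>\<^sub>0}"
  define f where "f w = (if w = 0 then -1 else Ln (1 - w) / w)" for w :: complex
  note S = plane_without_ray_from_1[folded S_def]
  have "(\<lambda>w. Ln (1 - w)) holomorphic_on S"
    by (intro holomorphic_intros) (auto simp: S_def)
  from pole_lemma_open[OF this S(1), of 0]
  have "(\<lambda>w. if w = 0 then deriv (\<lambda>w. Ln (1 - w)) 0 else Ln (1 - w) / w) holomorphic_on S"
    by (simp cong: if_cong)
  moreover have "deriv (\<lambda>w. Ln (1 - w)) 0 = (-1::complex)"
    by (rule DERIV_imp_deriv) (auto intro!: derivative_eq_intros)
  ultimately have "f holomorphic_on S" by (simp add: f_def[abs_def] cong: if_cong)
  then obtain P where P: "\<And>w. w \<in> S \<Longrightarrow> (P has_field_derivative f w) (at w)"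
    using starlike_holomorphic_primitive S by metis
  have eq: "dilog w = P 0 - P w" if w: "w \<in> S" for w
  proof -
    have seg: "of_real s * w \<in> S" if "s \<in> {0..1}" for s
      using that w scaled_not_on_ray by (auto simp: S_def)
    have "((\<lambda>s. w * f (of_real s * w)) has_integral (P (of_real 1 * w) - P (of_real 0 * w))) {0..1}"
    proof (rule fundamental_theorem_of_calculus)
      fix s :: real assume "s \<in> {0..1}"
      then have P': "(P has_field_derivative f (of_real s * w)) (at (of_real s * w))"
        by (intro P seg)
      have "((\<lambda>s. of_real s * w) has_vector_derivative w) (at s within {0..1})"
        by (auto intro!: derivative_eq_intros)
      from field_vector_diff_chain_within[OF this has_field_derivative_at_within[OF P']]
      show "((\<lambda>s. P (of_real s * w)) has_vector_derivative w * f (of_real s * w)) (at s within {0..1})"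
        by (simp add: o_def)
    qed simp
    then have "((\<lambda>s. w * f (of_real s * w)) has_integral (P w - P 0)) {0..1}" by simp
    then have "((\<lambda>s. Ln (1 - of_real s * w) / of_real s) has_integral (P w - P 0)) {0..1}"
      using has_integral_spike_finite[of "{0}" "{0..1}" "\<lambda>s. Ln (1 - of_real s * w) / of_real s"
          "\<lambda>s. w * f (of_real s * w)"] by (auto simp: f_def)
    then show ?thesis by (simp add: dilog_def integral_unique)
  qed
  have "((\<lambda>w. P 0 - P w) has_field_derivative - f z) (at z)"
    using P[of z] assms by (auto simp: S_def intro!: derivative_eq_intros)
  then have "(dilog has_field_derivative - f z) (at z)"
    by (rule has_field_derivative_transform_within_open[OF _ S(1)])
       (use assms eq in \<open>auto simp: S_def\<close>)
  then show ?thesis by (simp add: f_def)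
qed

text \<open>Beyond the branch point, the principal logarithm of \<open>1 - x\<close> is the limit from the upper half
  plane, that is, the limit of \<open>log (1 - w)\<close> for \<open>w\<close> in the lower half plane.\<close>

lemma Ln_one_minus_of_real:
  assumes "1 < x"
  shows "Ln (1 - complex_of_real x) = of_real (ln (x - 1)) + \<i> * pi"
  using Ln_of_real'[of "1 - x"] assms by simp

text \<open>The simple zero of the first factor dominates the logarithmic singularity of the second. This
  makes the right-hand side of the reflection formula continuous along the real line through
  \<open>w = 1\<close>.\<close>

lemma tendsto_Ln_times_Ln_one_minus:
  "((\<lambda>x. Ln (complex_of_real x) * Ln (1 - complex_of_real x)) \<longlongrightarrow> 0) (at 1)"
proof (rule Lim_null_comparison)
  have *: "norm (Ln (complex_of_real x) * Ln (1 - complex_of_real x))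
      \<le> 2 * \<bar>1 - x\<bar> * (2 / sqrt \<bar>1 - x\<bar> + pi)" if x: "x \<noteq> 1" "1/2 < x" "x < 3/2" for x
  proof -
    have 1: "norm (Ln (complex_of_real x)) \<le> 2 * \<bar>1 - x\<bar>"
    proof -
      have "ln x \<le> x - 1" using x by (intro ln_le_minus_one) auto
      moreover have "- ln x \<le> 2 * \<bar>1 - x\<bar>"
      proof (rule order.trans)
        have "ln (1 / x) \<le> 1 / x - 1" using x by (intro ln_le_minus_one) auto
        then show "- ln x \<le> (1 - x) / x" using x by (simp add: ln_div field_simps)
        show "(1 - x) / x \<le> 2 * \<bar>1 - x\<bar>"
        proof (cases "x < 1")
          case True
          then have "(1 - x) * (1 / x) \<le> (1 - x) * 2"
            using x by (intro mult_left_mono) (auto simp: field_simps)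
          then show ?thesis using True by simp
        next
          case False
          then have "(1 - x) / x \<le> 0" by (intro divide_nonpos_pos) auto
          then show ?thesis by (rule order.trans) simp
        qed
      qed
      moreover have "x - 1 \<le> 2 * \<bar>1 - x\<bar>" by (simp add: abs_if)
      ultimately have "\<bar>ln x\<bar> \<le> 2 * \<bar>1 - x\<bar>" by (intro abs_leI) (rule order.trans)
      then show ?thesis using x by (simp add: Ln_of_real)
    qed
    have "\<bar>ln \<bar>1 - x\<bar>\<bar> \<le> 2 / sqrt \<bar>1 - x\<bar>"
    proof -
      define y where "y = sqrt \<bar>1 - x\<bar>"
      have y: "0 < y" "y < 1" using x by (auto simp: y_def)
      have "\<bar>1 - x\<bar> = y ^ 2" by (simp add: y_def)
      then have "ln \<bar>1 - x\<bar> = 2 * ln y" using y by (simp add: ln_realpow)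
      moreover have "ln (1 / y) \<le> 1 / y - 1" using y by (intro ln_le_minus_one) auto
      moreover have "ln y < 0" using y by simp
      ultimately show ?thesis using y by (simp add: ln_div y_def[symmetric])
    qed
    moreover have "norm (Ln (1 - complex_of_real x)) \<le> \<bar>ln \<bar>1 - x\<bar>\<bar> + pi"
    proof -
      have "Ln (1 - complex_of_real x) = complex_of_real (ln \<bar>1 - x\<bar>) + (if 1 < x then pi else 0) * \<i>"
        using Ln_of_real'[of "1 - x"] x by simp
      also have "norm \<dots> \<le> norm (complex_of_real (ln \<bar>1 - x\<bar>)) + norm ((if 1 < x then pi else 0) * \<i>)"
        by (rule norm_triangle_ineq)
      also have "\<dots> \<le> \<bar>ln \<bar>1 - x\<bar>\<bar> + pi"
        by (simp add: norm_mult)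
      finally show ?thesis .
    qed
    ultimately have 2: "norm (Ln (1 - complex_of_real x)) \<le> 2 / sqrt \<bar>1 - x\<bar> + pi"
      by (meson add_mono_thms_linordered_semiring(3) order_trans)
    show ?thesis unfolding norm_mult by (intro mult_mono 1 2) auto
  qed
  show "\<forall>\<^sub>F x in at 1. norm (Ln (complex_of_real x) * Ln (1 - complex_of_real x))
      \<le> 2 * \<bar>1 - x\<bar> * (2 / sqrt \<bar>1 - x\<bar> + pi)"
    unfolding eventually_at dist_real_def
    by (intro exI[of _ "1/2"] conjI ballI impI *) (auto simp: abs_if split: if_splits)
  have "2 * \<bar>1 - x\<bar> * (2 / sqrt \<bar>1 - x\<bar> + pi) = 4 * sqrt \<bar>1 - x\<bar> + 2 * pi * \<bar>1 - x\<bar>" for x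
  proof -
    have "2 * y * (2 / z + pi) = 4 * (y / z) + 2 * pi * y" for y z :: real
      by (simp add: algebra_simps)
    then show ?thesis by (simp only: real_div_sqrt abs_ge_zero)
  qed
  then show "((\<lambda>x. 2 * \<bar>1 - x\<bar> * (2 / sqrt \<bar>1 - x\<bar> + pi)) \<longlongrightarrow> 0) (at 1)"
    by (auto intro!: tendsto_eq_intros)
qed

text \<open>Off the cut, the two sides of the reflection formula have the same derivative on the connected set
  \<open>\<complex> - (-\<infinity>, 0] - [1, \<infinity>)\<close>, which fixes \<open>C\<close>. For real \<open>w > 1\<close> the path of integration passes
  through the branch point, but both sides restrict to continuous primitives along the real line, so
  the fundamental theorem of calculus gives the formula with the same constant \<open>C\<close> and the principal
  value of \<open>log (1 - w)\<close>. Thus one formula covers both sides of the cut and the cut itself.\<close>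

lemma dilog_reflection:
  "\<exists>R C. \<forall>w. w \<notin> \<real>\<^sub>\<le>\<^sub>0 \<and> w \<noteq> 1 \<longrightarrow>
     (R has_field_derivative Ln w / (w - 1)) (at w) \<and> dilog w = C - Ln w * Ln (1 - w) + R w"
proof -
  define h where "h w = (if w = 1 then 1 else Ln w / (w - 1))" for w :: complex
  have S: "- \<real>\<^sub>\<le>\<^sub>0 = - (complex_of_real ` {..0})"
    by (auto simp: nonpos_Reals_def)
  have "Ln holomorphic_on - \<real>\<^sub>\<le>\<^sub>0" by (intro holomorphic_intros) auto
  from pole_lemma_open[OF this open_Compl[OF closed_nonpos_Reals_complex], of 1]
  have "(\<lambda>w. if w = 1 then deriv Ln 1 else Ln w / (w - 1)) holomorphic_on - \<real>\<^sub>\<le>\<^sub>0"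
    by (simp cong: if_cong)
  moreover have "deriv Ln 1 = (1::complex)"
    by (rule DERIV_imp_deriv) (auto intro!: derivative_eq_intros)
  ultimately have "h holomorphic_on - \<real>\<^sub>\<le>\<^sub>0" by (simp add: h_def[abs_def] cong: if_cong)
  moreover have "starlike (- \<real>\<^sub>\<le>\<^sub>0 :: complex set)"
    unfolding S by (rule starlike_slotted_complex_plane_left)
  ultimately obtain R where R: "\<And>w. w \<notin> \<real>\<^sub>\<le>\<^sub>0 \<Longrightarrow> (R has_field_derivative h w) (at w)"
    using starlike_holomorphic_primitive[of h "- \<real>\<^sub>\<le>\<^sub>0"] open_Compl[OF closed_nonpos_Reals_complex]
    by (metis ComplI)
  define D where "D = - (complex_of_real ` ({..0} \<union> {1..}))"
  have D: "w \<in> D \<longleftrightarrow> w \<notin> \<real>\<^sub>\<le>\<^sub>0 \<and> 1 - w \<notin> \<real>\<^sub>\<le>\<^sub>0" for w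
    by (auto simp: D_def complex_nonpos_Reals_iff image_iff complex_eq_iff)
  have "connected D" unfolding D_def
    by (intro starlike_imp_connected starlike_doubly_slotted_complex_plane) auto
  moreover have "open D"
  proof -
    have "D = - \<real>\<^sub>\<le>\<^sub>0 \<inter> {w. 1 - w \<notin> \<real>\<^sub>\<le>\<^sub>0}" by (auto simp: D)
    then show ?thesis by (auto intro!: open_Int plane_without_ray_from_1)
  qed
  moreover have "((\<lambda>w. dilog w + Ln w * Ln (1 - w) - R w) has_field_derivative 0) (at w)"
    if "w \<in> D" for w
  proof -
    have w: "w \<notin> \<real>\<^sub>\<le>\<^sub>0" "1 - w \<notin> \<real>\<^sub>\<le>\<^sub>0" "w \<noteq> 0" "w \<noteq> 1" using that by (auto simp: D)
    show ?thesis
      using w by (auto intro!: derivative_eq_intros dilog_has_field_derivative R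
          simp: h_def divide_simps) (auto simp: algebra_simps)
  qed
  ultimately have "(\<lambda>w. dilog w + Ln w * Ln (1 - w) - R w) constant_on D"
    by (intro has_field_derivative_0_imp_constant_on) auto
  then obtain C where C: "\<And>w. w \<in> D \<Longrightarrow> dilog w + Ln w * Ln (1 - w) - R w = C"
    by (auto simp: constant_on_def)
  \<comment> \<open>\<open>K\<close> is a primitive of \<open>log (1 - u) / u\<close> on the real line. The two expressions for it agree on
    \<open>(0, 1)\<close>; the first is regular at \<open>0\<close> and the second continues past \<open>1\<close>.\<close>
  define E where "E u = Ln (complex_of_real u) * Ln (1 - of_real u) - R (of_real u) - C" for u
  define K where "K u = (if u < 1 then - dilog (complex_of_real u) else E u)" for u
  have KE: "K u = E u" if "0 < u" for u
    using C[of "of_real u"] that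
    by (auto simp: K_def E_def D complex_nonpos_Reals_iff algebra_simps)
  have K_left: "(K has_vector_derivative (if complex_of_real u = 0 then - 1 else Ln (1 - of_real u) / of_real u)) (at u)"
    if "u < 1" for u
  proof -
    have "((\<lambda>u. - dilog (complex_of_real u)) has_vector_derivative
        (if complex_of_real u = 0 then - 1 else Ln (1 - of_real u) / of_real u)) (at u)"
      using DERIV_minus[OF dilog_has_field_derivative[of "of_real u"]] that
      by (intro has_vector_derivative_real_field) (simp add: complex_nonpos_Reals_iff)
    then show ?thesis
      by (rule has_vector_derivative_transform_within_open[of _ _ _ "{..<1}"])
         (use that in \<open>auto simp: K_def\<close>)
  qed
  have K_right: "(K has_vector_derivative Ln (1 - of_real u) / of_real u) (at u)" if u: "1 < u" for u
  proof -
    have "((\<lambda>u. R (of_real u)) has_vector_derivative Ln (of_real u) / (of_real u - 1)) (at u)"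
      by (rule has_vector_derivative_real_field) (use R[of "of_real u"] u in \<open>auto simp: h_def\<close>)
    then have "((\<lambda>u. of_real (ln u) * (of_real (ln (u - 1)) + \<i> * pi) - R (of_real u) - C)
        has_vector_derivative Ln (1 - of_real u) / of_real u) (at u)"
      using u by (auto intro!: derivative_eq_intros
          simp: Ln_one_minus_of_real Ln_of_real has_real_derivative_iff_has_vector_derivative[symmetric]
             divide_simps)
    then show ?thesis
      by (rule has_vector_derivative_transform_within_open[of _ _ _ "{1<..}"])
         (use u in \<open>auto simp: K_def E_def Ln_one_minus_of_real Ln_of_real\<close>)
  qed
  have K_cont: "isCont K u" for u
  proof (cases "u = 1")
    case True
    have "((\<lambda>u. R (complex_of_real u)) \<longlongrightarrow> R (of_real 1)) (at 1)"
      using DERIV_isCont[OF R[of 1]]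
      by (intro isCont_tendsto_compose[of _ R]) (auto intro!: tendsto_eq_intros)
    from tendsto_diff[OF tendsto_diff[OF tendsto_Ln_times_Ln_one_minus this] tendsto_const[of C]]
    have "(E \<longlongrightarrow> E 1) (at 1)" unfolding E_def by simp
    moreover have "\<forall>\<^sub>F u in at 1. E u = K u"
      unfolding eventually_at by (rule exI[of _ 1]) (auto simp: KE dist_real_def)
    ultimately show ?thesis
      using True KE[of 1] by (auto simp: isCont_def intro: Lim_transform_eventually)
  next
    case False
    then show ?thesis
      using K_left[of u] K_right[of u] has_vector_derivative_continuous by (cases "u < 1") force+
  qed
  have "dilog w = C - Ln w * Ln (1 - w) + R w" if w: "w \<notin> \<real>\<^sub>\<le>\<^sub>0" "w \<noteq> 1" for w
  proof (cases "w \<in> D")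
    case True
    then show ?thesis using C[of w] by (simp add: algebra_simps)
  next
    case False
    then obtain x where x: "w = of_real x" "1 < x"
      using w by (force simp: D_def nonpos_Reals_def)
    have "((\<lambda>s. Ln (1 - of_real s * w) / of_real s) has_integral (K (1 * x) - K (0 * x))) {0..1}"
    proof (rule fundamental_theorem_of_calculus_interior_strong[where S = "{1 / x}"])
      show "continuous_on {0..1} (\<lambda>s. K (s * x))"
        by (intro continuous_at_imp_continuous_on ballI isCont_o2[OF _ K_cont]) (auto intro!: continuous_intros)
      fix s assume s: "s \<in> {0<..<1} - {1 / x}"
      have "(K has_vector_derivative Ln (1 - of_real (s * x)) / of_real (s * x)) (at (s * x))"
        using s x K_left[of "s * x"] K_right[of "s * x"] by (cases "s * x < 1") (auto simp: field_simps)
      then have "((K \<circ> (\<lambda>s. s * x)) has_vector_derivative x *\<^sub>R (Ln (1 - of_real (s * x)) / of_real (s * x))) (at s)"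
        by (intro vector_diff_chain_at) (auto intro!: derivative_eq_intros)
      then show "((\<lambda>s. K (s * x)) has_vector_derivative Ln (1 - of_real s * w) / of_real s) (at s)"
        using x s by (simp add: o_def scaleR_conv_of_real)
    qed auto
    then have "dilog w = - E x"
      using x KE[of x] by (simp add: dilog_def integral_unique K_def dilog_def)
    then show ?thesis using x by (simp add: E_def)
  qed
  moreover have "(R has_field_derivative Ln w / (w - 1)) (at w)" if "w \<notin> \<real>\<^sub>\<le>\<^sub>0" "w \<noteq> 1" for w
    using R[of w] that by (simp add: h_def)
  ultimately show ?thesis by blast
qed

section \<open>The derivative of the magnetic central charge\<close>

lemma exp_on_base:
  assumes "t \<in> base"
  shows "exp (2 * pi * \<i> * t) \<notin> \<real>\<^sub>\<le>\<^sub>0" "exp (2 * pi * \<i> * t) \<noteq> 1"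
    "Ln (exp (2 * pi * \<i> * t)) = 2 * pi * \<i> * t"
    "1 - exp (2 * pi * \<i> * t) \<notin> \<real>\<^sub>\<le>\<^sub>0 \<longleftrightarrow> t \<notin> cut"
proof -
  have t: "\<bar>Re t\<bar> < 1/2" "t \<noteq> 0" using assms by (auto simp: base_def)
  have b: "\<bar>2 * pi * Re t\<bar> < pi" using t pi_gt_zero by (simp add: abs_mult)
  show Ln: "Ln (exp (2 * pi * \<i> * t)) = 2 * pi * \<i> * t"
    using b by (intro Ln_exp) (auto simp: abs_less_iff)
  show "exp (2 * pi * \<i> * t) \<noteq> 1" using Ln t by auto
  show "exp (2 * pi * \<i> * t) \<notin> \<real>\<^sub>\<le>\<^sub>0"
  proof
    assume "exp (2 * pi * \<i> * t) \<in> \<real>\<^sub>\<le>\<^sub>0"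
    then have s: "sin (2 * pi * Re t) = 0" and c: "exp (- 2 * pi * Im t) * cos (2 * pi * Re t) \<le> 0"
      by (auto simp: complex_nonpos_Reals_iff Re_exp Im_exp)
    have "2 * pi * Re t = 0" using s b sin_eq_0_pi[of "2 * pi * Re t"] by linarith
    with c show False by simp
  qed
  show "1 - exp (2 * pi * \<i> * t) \<notin> \<real>\<^sub>\<le>\<^sub>0 \<longleftrightarrow> t \<notin> cut"
  proof -
    have "1 - exp (2 * pi * \<i> * t) \<in> \<real>\<^sub>\<le>\<^sub>0 \<longleftrightarrow>
        1 \<le> exp (- 2 * pi * Im t) * cos (2 * pi * Re t) \<and> sin (2 * pi * Re t) = 0"
      by (auto simp: complex_nonpos_Reals_iff Re_exp Im_exp)
    also have "\<dots> \<longleftrightarrow> 1 \<le> exp (- 2 * pi * Im t) \<and> Re t = 0"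
    proof -
      have "sin (2 * pi * Re t) = 0 \<longleftrightarrow> 2 * pi * Re t = 0"
        using b sin_eq_0_pi[of "2 * pi * Re t"] by (metis abs_less_iff minus_less_iff sin_zero)
      also have "\<dots> \<longleftrightarrow> Re t = 0" by simp
      finally show ?thesis by auto
    qed
    also have "\<dots> \<longleftrightarrow> t \<in> cut"
      by (auto simp: cut_def mult_le_0_iff pi_gt_zero[THEN less_le_not_le[THEN iffD1]])
    finally show ?thesis by simp
  qed
qed

lemma open_base: "open base"
  unfolding base_def
  by (intro open_Collect_conj open_Collect_neq open_Collect_less continuous_intros)

text \<open>The analytic germ at \<open>t\<^sub>0\<close> of \<open>log (1 - e\<^sup>2\<^sup>\<pi>\<^sup>i\<^sup>t)\<close>. The correction of the
  principal value sets in exactly where \<^const>\<open>flat_germ\<close> adds a multiple of \<open>\<beta>\<close>: the monodromy of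
  the lattice is that of this logarithm.\<close>

definition log_germ :: "complex \<Rightarrow> complex \<Rightarrow> complex" where
  "log_germ t0 t = Ln (1 - exp (2 * pi * \<i> * t)) +
     (if t0 \<in> cut \<and> Re t > 0 then 2 * pi * \<i> else 0)"

text \<open>Near a point of the cut, \<open>q = e\<^sup>2\<^sup>\<pi>\<^sup>i\<^sup>t\<close> has \<open>Re q > 1\<close>, and \<open>log (q - 1) + \<pi>i\<close> is a holomorphic
  branch of \<open>log (1 - q)\<close>. It equals the principal one for \<open>Re t \<le> 0\<close> and the principal
  one plus \<open>2\<pi>i\<close> for \<open>Re t > 0\<close>.\<close>

lemma log_germ_has_field_derivative:
  assumes "t \<in> base"
  shows "(log_germ t has_field_derivative
    - (2 * pi * \<i> * exp (2 * pi * \<i> * t) / (1 - exp (2 * pi * \<i> * t)))) (at t)"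
proof (cases "t \<in> cut")
  case False
  then have "1 - exp (2 * pi * \<i> * t) \<notin> \<real>\<^sub>\<le>\<^sub>0" using exp_on_base(4)[OF assms] by simp
  then have "((\<lambda>t. Ln (1 - exp (2 * pi * \<i> * t))) has_field_derivative
      - (2 * pi * \<i> * exp (2 * pi * \<i> * t) / (1 - exp (2 * pi * \<i> * t)))) (at t)"
    by (auto intro!: derivative_eq_intros simp: field_simps)
  then show ?thesis using False by (simp add: log_germ_def[abs_def])
next
  case True
  define q where "q s = exp (2 * pi * \<i> * s)" for s
  have "0 < - Im t" using True assms by (auto simp: cut_def base_def complex_eq_iff less_le)
  then have "1 < exp (- 2 * pi * Im t)" by (simp add: mult_less_0_iff)
  then have qt: "1 < Re (q t)" using True by (simp add: q_def Re_exp cut_def)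
  define G where "G = {s. \<bar>Re s\<bar> < 1/2} \<inter> {s. 1 < Re (q s)}"
  have G: "open G" "t \<in> G"
    unfolding G_def q_def using qt assms
    by (auto simp: q_def base_def intro!: open_Int open_Collect_less continuous_intros)
  have eq: "Ln (q s - 1) + \<i> * pi = log_germ t s" if s: "s \<in> G" for s
  proof -
    have re: "0 < Re (q s - 1)" using s by (auto simp: G_def)
    have b: "\<bar>2 * pi * Re s\<bar> < pi" using s pi_gt_zero by (auto simp: G_def abs_mult)
    have im: "Im (q s) \<le> 0 \<longleftrightarrow> Re s \<le> 0"
    proof -
      have "Im (q s) = exp (- 2 * pi * Im s) * sin (2 * pi * Re s)" by (simp add: q_def Im_exp)
      moreover have "sin (2 * pi * Re s) > 0" if "Re s > 0" using that b
        by (intro sin_gt_zero) auto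
      moreover have "sin (2 * pi * Re s) \<le> 0" if "Re s \<le> 0"
        using that b sin_ge_zero[of "- (2 * pi * Re s)"] by (auto simp: mult_nonneg_nonpos)
      ultimately show ?thesis
        by (metis exp_gt_zero mult_nonneg_nonpos mult_pos_pos not_le order_less_imp_le)
    qed
    have "Ln (1 - q s) = (if Re s \<le> 0 then Ln (q s - 1) + \<i> * pi else Ln (q s - 1) - \<i> * pi)"
      using Ln_minus[of "q s - 1"] re im by (auto simp: complex_eq_iff)
    then show ?thesis using True by (auto simp: log_germ_def q_def)
  qed
  have "((\<lambda>s. Ln (q s - 1) + \<i> * pi) has_field_derivative 2 * pi * \<i> * q t / (q t - 1)) (at t)"
    unfolding q_def using qt
    by (auto intro!: derivative_eq_intros simp: complex_nonpos_Reals_iff q_def field_simps)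
  then have "(log_germ t has_field_derivative 2 * pi * \<i> * q t / (q t - 1)) (at t)"
    by (rule has_field_derivative_transform_within_open[OF _ G]) (rule eq)
  moreover have "2 * pi * \<i> * q t / (q t - 1) = - (2 * pi * \<i> * q t / (1 - q t))"
    by (metis minus_diff_eq minus_divide_right)
  ultimately show ?thesis by (simp only: q_def)
qed

text \<open>After the reflection formula is substituted, the jump of \<open>log (1 - q)\<close> contributes \<open>-t\<close> to the
  dual period for \<open>Re t > 0\<close>, and the flat extension of \<open>\<beta>\<^sup>\<or>\<close> contributes \<open>Z\<^sub>\<beta> = t\<close>. What remains is
  holomorphic; in its derivative the terms with \<open>1 - q\<close> in the denominator cancel.\<close>

lemma Zc'_magnetic:
  assumes t: "t \<in> base"
  shows "Zc' t (0, 0, 1) =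
    1 / (2 * pi * \<i>) * (Ln (1 - exp (2 * pi * \<i> * t)) - Ln (exp (2 * pi * \<i> * t)))"
proof -
  obtain R C
    where R: "\<And>w. w \<notin> \<real>\<^sub>\<le>\<^sub>0 \<Longrightarrow> w \<noteq> 1 \<Longrightarrow> (R has_field_derivative Ln w / (w - 1)) (at w)"
      and refl: "\<And>w. w \<notin> \<real>\<^sub>\<le>\<^sub>0 \<Longrightarrow> w \<noteq> 1 \<Longrightarrow> dilog w = C - Ln w * Ln (1 - w) + R w"
    using dilog_reflection by blast
  define c where "c = 2 * pi * \<i>"
  have c0: "c \<noteq> 0" by (simp add: c_def)
  note base = exp_on_base[folded c_def]
  define F where "F s = - 1 / c\<^sup>2 * (1/2 * (c * s)\<^sup>2 + (C - c * s * log_germ t s + R (exp (c * s))))" for s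
  have eq: "F s = Zc s (flat_germ t (0, 0, 1) s)" if s: "s \<in> base" for s
  proof -
    define e :: complex where "e = (if t \<in> cut \<and> Re s > 0 then 1 else 0)"
    have "Ln (1 - exp (c * s)) = log_germ t s - e * c"
      by (simp add: log_germ_def c_def e_def)
    then have dilog: "dilog (exp (c * s)) = C - c * s * (log_germ t s - e * c) + R (exp (c * s))"
      using refl[OF base(1,2)[OF s]] base(3)[OF s] by simp
    have "Zc s (flat_germ t (0, 0, 1) s) = e * s + Z_dual s"
      by (simp add: Zc_def flat_germ_def e_def)
    also have "Z_dual s = - 1 / c\<^sup>2 * (1/2 * (c * s)\<^sup>2 + dilog (exp (c * s)))"
      unfolding Z_dual_def c_def[symmetric] base(3)[OF s] ..
    finally show ?thesis
      using c0 by (simp add: dilog F_def field_simps power2_eq_square)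
  qed
  have dlog: "(log_germ t has_field_derivative - (c * exp (c * t) / (1 - exp (c * t)))) (at t)"
    using log_germ_has_field_derivative[OF t] by (simp add: c_def)
  have dR: "((\<lambda>s. R (exp (c * s))) has_field_derivative
      Ln (exp (c * t)) / (exp (c * t) - 1) * (exp (c * t) * c)) (at t)"
    by (rule DERIV_chain2[where f = R and g = "\<lambda>s. exp (c * s)" and x = t,
        OF R[OF base(1,2)[OF t]]]) (auto intro!: derivative_eq_intros)
  have "(F has_field_derivative - 1 / c\<^sup>2 * (c * (c * t) - c * log_germ t t)) (at t)"
  proof -
    have q: "exp (c * t) - 1 \<noteq> 0" "1 - exp (c * t) \<noteq> 0" using base(2)[OF t] by auto
    show ?thesis unfolding F_def
      by (rule derivative_eq_intros dlog dR refl | simp)+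
         (use q base(3)[OF t] in \<open>simp add: divide_simps power2_eq_square\<close>,
          simp add: algebra_simps)
  qed
  then have "((\<lambda>s. Zc s (flat_germ t (0, 0, 1) s)) has_field_derivative
      - 1 / c\<^sup>2 * (c * (c * t) - c * log_germ t t)) (at t)"
    by (rule has_field_derivative_transform_within_open[OF _ open_base t]) (rule eq)
  then have "Zc' t (0, 0, 1) = - 1 / c\<^sup>2 * (c * (c * t) - c * log_germ t t)"
    unfolding Zc'_def by (rule DERIV_imp_deriv)
  also have "\<dots> = 1 / c * (log_germ t t - c * t)"
    using c0 by (simp add: field_simps power2_eq_square)
  also have "log_germ t t = Ln (1 - exp (c * t))" by (auto simp: log_germ_def c_def cut_def)
  finally show ?thesis using base(3)[OF t] by (simp add: c_def)
qed

lemma Zc'_electric: "Zc' t (n, k, 0) = of_int k"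
proof -
  have "((\<lambda>s. of_int n + of_int k * s) has_field_derivative of_int k) (at t)"
    by (auto intro!: derivative_eq_intros)
  moreover have "(\<lambda>s. Zc s (flat_germ t (n, k, 0) s)) = (\<lambda>s. of_int n + of_int k * s)"
    by (auto simp: Zc_def flat_germ_def)
  ultimately show ?thesis unfolding Zc'_def by (simp add: DERIV_imp_deriv)
qed

section \<open>Continuation of the logarithm along a local frame\<close>

text \<open>The difference of the two sides, divided by \<open>2\<pi>i\<close>, is an integer at each point. It is
  continuous, because the jumps of the principal logarithm and of \<open>k\<close> across the cut agree: both are
  those of a germ. So it is constant on the connected set \<open>U\<close>, and it vanishes at the base point of
  the frame.\<close>

lemma local_frame_log:
  assumes "local_frame U k L" and "t \<in> U"
  shows "L t = Ln (1 - exp (2 * pi * \<i> * t)) + 2 * pi * \<i> * of_int (k t)"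
proof -
  define d where "d t = (L t - Ln (1 - exp (2 * pi * \<i> * t))) / (2 * pi * \<i>) - of_int (k t)" for t
  have U: "open U" "U \<subseteq> base" "connected U" "L holomorphic_on U"
    and flat: "\<And>t0. t0 \<in> U \<Longrightarrow> \<forall>\<^sub>F t in nhds t0. (0, k t, 1) = flat_germ t0 (0, k t0, 1) t"
    and exp_L: "\<And>t. t \<in> U \<Longrightarrow> exp (L t) = 1 - exp (2 * pi * \<i> * t)"
    using assms(1) by (auto simp: local_frame_def flat_frame_def flat_section_def)
  obtain t1 where t1: "t1 \<in> U" "d t1 = 0"
    using assms(1) by (auto simp: local_frame_def d_def)
  have int: "d t \<in> \<int>" if "t \<in> U" for t
  proof -
    have "t \<in> base" using that U by auto
    then have "exp (L t) = exp (Ln (1 - exp (2 * pi * \<i> * t)))"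
      using exp_on_base(2) exp_L[OF that] by simp
    then obtain n :: int where "L t = Ln (1 - exp (2 * pi * \<i> * t)) + (of_int (2 * n) * pi) * \<i>"
      unfolding exp_eq by blast
    then have "d t = of_int (n - k t)" by (simp add: d_def field_simps)
    then show ?thesis by simp
  qed
  have "continuous_on U d"
  proof (rule continuous_at_imp_continuous_on, rule ballI)
    fix t0 assume t0: "t0 \<in> U"
    have "isCont L t0"
      using U t0 by (meson holomorphic_on_imp_continuous_on continuous_on_eq_continuous_at)
    moreover have "isCont (log_germ t0) t0"
      using log_germ_has_field_derivative U t0 DERIV_isCont by blast
    ultimately have "isCont (\<lambda>t. (L t - log_germ t0 t) / (2 * pi * \<i>) - of_int (k t0)) t0"
      by (intro continuous_intros) auto
    moreover have "\<forall>\<^sub>F t in nhds t0. (L t - log_germ t0 t) / (2 * pi * \<i>) - of_int (k t0) = d t"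
      using flat[OF t0]
      by eventually_elim (auto simp: d_def flat_germ_def log_germ_def field_simps split: if_splits)
    ultimately show "isCont d t0" using isCont_cong by force
  qed
  then have "d constant_on U"
  proof (rule continuous_discrete_range_constant[OF U(3)])
    fix x assume x: "x \<in> U"
    have "1 \<le> norm (d y - d x)" if y: "y \<in> U" "d y \<noteq> d x" for y
    proof -
      obtain a b where "d y = of_int a" "d x = of_int b" using int x y by (metis Ints_cases)
      then have "norm (d y - d x) = real_of_int \<bar>a - b\<bar>" "a \<noteq> b"
        using y by (auto simp: norm_of_int simp flip: of_int_diff)
      then show ?thesis by simp
    qed
    then show "\<exists>e>0. \<forall>y. y \<in> U \<and> d y \<noteq> d x \<longrightarrow> e \<le> norm (d y - d x)"
      by (intro exI[of _ 1]) auto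
  qed
  then have "d t = 0" using t1 assms(2) by (metis constant_on_def)
  then show ?thesis by (simp add: d_def field_simps)
qed

section \<open>Convergence of the instanton sums\<close>

lemma exp_minus_le_inverse_square:
  fixes y :: real assumes "0 < y" shows "exp (- y) \<le> 2 / y\<^sup>2"
proof -
  have "y\<^sup>2 / 2 \<le> exp y"
    using exp_lower_Taylor_quadratic[of y] assms by linarith
  then show ?thesis using assms by (simp add: exp_minus field_simps)
qed

text \<open>From \<open>e\<^sup>-\<^sup>y \<le> 2/y\<^sup>2\<close> at \<open>y = x cosh s\<close> and \<open>cosh (\<nu>s) \<le> cosh s\<close>, the integrand is at most
  \<open>2 / (x\<^sup>2 cosh s) \<le> 4 e\<^sup>-\<^sup>s / x\<^sup>2\<close>. The exponential decay in \<open>x\<close> is given up; the inverse square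
  is enough to sum over both the multiples \<open>m\<gamma>\<close> and the charges \<open>\<gamma>\<close>.\<close>

lemma besselK_bounds:
  assumes "0 < x" "\<bar>\<nu>\<bar> \<le> 1"
  shows "0 \<le> besselK \<nu> x" "besselK \<nu> x \<le> 4 / x\<^sup>2"
proof -
  let ?f = "\<lambda>s. exp (- x * cosh s) * cosh (\<nu> * s)"
  show "0 \<le> besselK \<nu> x"
    \<comment> \<open>Without integrability the integral is zero by convention, here and below.\<close>
    by (cases "?f integrable_on {0..}")
      (auto simp: besselK_def not_integrable_integral intro!: integral_nonneg)
  have le: "?f s \<le> 4 / x\<^sup>2 * exp (- 1 * s)" if "0 \<le> s" for s
  proof -
    have "cosh (\<nu> * s) = cosh (\<bar>\<nu>\<bar> * s)" by (simp add: abs_if)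
    also have "\<dots> \<le> cosh s"
      using that assms by (intro cosh_real_nonneg_le_iff[THEN iffD2]) (auto intro: mult_left_le_one_le)
    finally have "?f s \<le> exp (- (x * cosh s)) * cosh s" by (simp add: mult_left_mono)
    also have "\<dots> \<le> 2 / (x * cosh s)\<^sup>2 * cosh s"
      using assms by (intro mult_right_mono exp_minus_le_inverse_square) auto
    also have "\<dots> = 2 / x\<^sup>2 * (1 / cosh s)" by (simp add: power2_eq_square)
    also have "\<dots> \<le> 2 / x\<^sup>2 * (2 * exp (- s))"
    proof (rule mult_left_mono)
      have "exp s \<le> 2 * cosh s" by (simp add: cosh_def)
      then show "1 / cosh s \<le> 2 * exp (- s)" by (simp add: exp_minus field_simps)
    qed simp
    finally show ?thesis by simp
  qed
  have int: "((\<lambda>s. 4 / x\<^sup>2 * exp (- 1 * s)) has_integral 4 / x\<^sup>2 * 1) {0..}"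
    using has_integral_exp_minus_to_infinity[of 1 0] by (intro has_integral_mult_right) simp
  show "besselK \<nu> x \<le> 4 / x\<^sup>2"
  proof (cases "?f integrable_on {0..}")
    case True
    then have "(?f has_integral besselK \<nu> x) {0..}"
      by (simp only: besselK_def integrable_integral)
    then have "besselK \<nu> x \<le> 4 / x\<^sup>2 * 1"
      by (rule has_integral_le[OF _ int]) (use le in auto)
    then show ?thesis by simp
  next
    case False
    then show ?thesis by (simp add: besselK_def not_integrable_integral)
  qed
qed

lemma summable_on_by_norm_comparison:
  fixes f :: "'a \<Rightarrow> 'b :: banach"
  assumes "g summable_on A" "\<And>x. x \<in> A \<Longrightarrow> norm (f x) \<le> g x"
  shows "f summable_on A"
  using Infinite_Sum.abs_summable_on_comparison_test'[OF assms] by (rule abs_summable_summable)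

lemma summable_inverse_squares: "(\<lambda>m::nat. 1 / (real m)\<^sup>2) summable_on A"
proof -
  have "summable (\<lambda>m::nat. 1 / (real m)\<^sup>2)"
    using inverse_power_summable[of 2, where 'a = real] by (simp add: field_simps)
  then have "(\<lambda>m::nat. 1 / (real m)\<^sup>2) summable_on UNIV"
    by (rule summable_nonneg_imp_summable_on) simp
  then show ?thesis by (rule summable_on_subset_banach) simp
qed

definition sum_inverse_squares :: real where "sum_inverse_squares = (\<Sum>\<^sub>\<infinity>m\<in>{0<..}. 1 / (real m)\<^sup>2)"

text \<open>The phases have modulus one, and \<open>4 / (2\<pi> m |z|)\<^sup>2 \<le> 1 / (m |z|)\<^sup>2\<close>.\<close>

lemma bessel_series_bound:
  assumes "z \<noteq> 0" "\<bar>\<nu>\<bar> \<le> 1"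
  shows "cmod (\<Sum>\<^sub>\<infinity>m\<in>{0<..}. cis_mult m a * besselK \<nu> (2 * pi * real m * cmod z)) \<le> sum_inverse_squares / (cmod z)\<^sup>2"
proof (rule norm_infsum_le)
  let ?f = "\<lambda>m. cis_mult m a * besselK \<nu> (2 * pi * real m * cmod z)"
  let ?g = "\<lambda>m. 1 / (real m)\<^sup>2 * (1 / (cmod z)\<^sup>2)"
  have le: "norm (?f m) \<le> ?g m" if "m \<in> {0<..}" for m
  proof -
    have x: "0 < 2 * pi * real m * cmod z" using that assms by simp
    have "norm (?f m) = besselK \<nu> (2 * pi * real m * cmod z)"
      using besselK_bounds(1)[OF x assms(2)] by (simp add: norm_mult cis_mult.rep_eq)
    also have "\<dots> \<le> 4 / (2 * pi * real m * cmod z)\<^sup>2" by (rule besselK_bounds(2)[OF x assms(2)])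
    also have "\<dots> = 1 / (real m)\<^sup>2 * (1 / (cmod z)\<^sup>2) * (1 / pi\<^sup>2)"
      by (simp add: power_mult_distrib)
    also have "\<dots> \<le> ?g m"
      using pi_ge_two by (intro mult_left_le) (auto simp: power_le_one_iff one_le_power)
    finally show ?thesis .
  qed
  have g: "?g summable_on {0<..}" by (intro summable_on_cmult_left summable_inverse_squares)
  then have "?f summable_on {0<..}" by (rule summable_on_by_norm_comparison) (rule le)
  then show "(?f has_sum infsum ?f {0<..}) {0<..}" by (rule has_sum_infsum)
  show "(?g has_sum sum_inverse_squares / (cmod z)\<^sup>2) {0<..}"
    using has_sum_cmult_left[OF has_sum_infsum[OF summable_inverse_squares[of "{0<..}"]],
        of "1 / (cmod z)\<^sup>2"]
    by (simp add: sum_inverse_squares_def)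
  show "norm (?f m) \<le> ?g m" if "m \<in> {0<..}" for m using that by (rule le)
qed

lemma V_inst_bound:
  assumes "Zc t \<gamma> \<noteq> 0"
  shows "cmod (V_inst \<gamma> (t, \<theta>)) \<le> sum_inverse_squares / (cmod (Zc t \<gamma>))\<^sup>2"
proof -
  have "cmod (V_inst \<gamma> (t, \<theta>)) = 1 / (2 * pi) *
     cmod (\<Sum>\<^sub>\<infinity>m\<in>{0<..}. cis_mult m (\<theta> \<gamma>) * besselK 0 (2 * pi * real m * cmod (Zc t \<gamma>)))"
    by (simp add: V_inst_def norm_mult norm_divide)
  also have "\<dots> \<le> 1 * cmod (\<Sum>\<^sub>\<infinity>m\<in>{0<..}. cis_mult m (\<theta> \<gamma>) * besselK 0 (2 * pi * real m * cmod (Zc t \<gamma>)))"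
    using pi_ge_two by (intro mult_right_mono) auto
  also have "\<dots> \<le> sum_inverse_squares / (cmod (Zc t \<gamma>))\<^sup>2"
    using bessel_series_bound[OF assms, of 0] by simp
  finally show ?thesis .
qed

lemma A_inst_factored:
  "A_inst \<gamma> (t, \<theta>) X = - 1 / (4 * pi) *
     (cmod (Zc t \<gamma>) * (dZ (t, \<theta>) \<gamma> X / Zc t \<gamma> - cnj (dZ (t, \<theta>) \<gamma> X / Zc t \<gamma>))) *
     (\<Sum>\<^sub>\<infinity>m\<in>{0<..}. cis_mult m (\<theta> \<gamma>) * besselK 1 (2 * pi * real m * cmod (Zc t \<gamma>)))"
proof -
  define D where "D = dZ (t, \<theta>) \<gamma> X / Zc t \<gamma> - cnj (dZ (t, \<theta>) \<gamma> X / Zc t \<gamma>)"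
  define K where "K m = complex_of_real (besselK 1 (2 * pi * real m * cmod (Zc t \<gamma>)))" for m
  have "(\<Sum>\<^sub>\<infinity>m\<in>{0<..}. cis_mult m (\<theta> \<gamma>) * cmod (Zc t \<gamma>) * K m * D) =
      (\<Sum>\<^sub>\<infinity>m\<in>{0<..}. (cmod (Zc t \<gamma>) * D) * (cis_mult m (\<theta> \<gamma>) * K m))"
    by (intro infsum_cong) (simp add: mult_ac)
  also have "\<dots> = (cmod (Zc t \<gamma>) * D) * (\<Sum>\<^sub>\<infinity>m\<in>{0<..}. cis_mult m (\<theta> \<gamma>) * K m)"
    by (rule infsum_cmult_right')
  finally show ?thesis by (simp add: A_inst_def D_def K_def)
qed

lemma A_inst_bound:
  assumes "Zc t \<gamma> \<noteq> 0"
  shows "cmod (A_inst \<gamma> (t, \<theta>) X) \<le> cmod (dZ (t, \<theta>) \<gamma> X) * (sum_inverse_squares / (cmod (Zc t \<gamma>))\<^sup>2)"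
proof -
  define z where "z = Zc t \<gamma>"
  define d where "d = dZ (t, \<theta>) \<gamma> X"
  define K where "K = (\<Sum>\<^sub>\<infinity>m\<in>{0<..}. cis_mult m (\<theta> \<gamma>) * besselK 1 (2 * pi * real m * cmod z))"
  have "cmod (d / z - cnj (d / z)) \<le> cmod (d / z) + cmod (d / z)"
    using norm_triangle_ineq4[of "d / z" "cnj (d / z)"] by (simp only: complex_mod_cnj)
  then have 1: "cmod z * cmod (d / z - cnj (d / z)) \<le> 2 * cmod d"
    using assms by (simp add: z_def[symmetric] norm_divide field_simps)
  have 2: "cmod K \<le> sum_inverse_squares / (cmod z)\<^sup>2"
    unfolding K_def z_def using assms by (intro bessel_series_bound) auto
  have "cmod (A_inst \<gamma> (t, \<theta>) X) = 1 / (4 * pi) * (cmod z * cmod (d / z - cnj (d / z)) * cmod K)"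
    by (simp add: A_inst_factored norm_mult norm_divide z_def d_def K_def)
  also have "\<dots> \<le> 1 / (4 * pi) * (2 * cmod d * cmod K)"
    by (intro mult_left_mono mult_right_mono 1) auto
  also have "\<dots> \<le> 1 / 2 * (2 * cmod d * cmod K)"
    using pi_ge_two by (intro mult_right_mono) (auto simp: field_simps)
  also have "\<dots> \<le> cmod d * (sum_inverse_squares / (cmod z)\<^sup>2)" using mult_left_mono[OF 2, of "cmod d"] by simp
  finally show ?thesis by (simp add: z_def d_def)
qed

lemma Zc_electric: "Zc t (n, k, 0) = of_int n + of_int k * t"
  by (simp add: Zc_def)

text \<open>The strip \<open>|Re t| < 1/2\<close> contains no nonzero integer, and \<open>|n| - 1/2 \<ge> |n| / 2\<close>.\<close>

lemma cmod_minus_int_ge: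
  assumes "t \<in> base" "n \<noteq> 0"
  shows "\<bar>real_of_int n\<bar> / 2 \<le> cmod (t - of_int n)"
proof -
  have "\<bar>Re t\<bar> < 1/2" using assms by (auto simp: base_def)
  moreover have "1 \<le> \<bar>real_of_int n\<bar>" using assms(2) by linarith
  moreover have "\<bar>Re t - real_of_int n\<bar> \<le> cmod (t - of_int n)"
    using abs_Re_le_cmod[of "t - of_int n"] by simp
  ultimately show ?thesis by linarith
qed

lemma summable_inverse_square_distances:
  assumes "t \<in> base"
  shows "(\<lambda>n::int. 1 / (cmod (t - of_int n))\<^sup>2) summable_on UNIV"
proof -
  let ?f = "\<lambda>n::int. 1 / (cmod (t - of_int n))\<^sup>2"
  have "?f summable_on ((\<lambda>m. e * int m) ` {0<..})" if e: "\<bar>e\<bar> = 1" for e :: int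
  proof -
    have "(?f \<circ> (\<lambda>m. e * int m)) summable_on {0<..}"
    proof (rule summable_on_by_norm_comparison)
      show "(\<lambda>m. 4 * (1 / (real m)\<^sup>2)) summable_on {0<..}"
        by (intro summable_on_cmult_right summable_inverse_squares)
      fix m :: nat assume "m \<in> {0<..}"
      then have "\<bar>real_of_int (e * int m)\<bar> / 2 \<le> cmod (t - of_int (e * int m))"
        using e by (intro cmod_minus_int_ge[OF assms]) auto
      moreover have "\<bar>real_of_int (e * int m)\<bar> = real m"
        using e by (metis abs_mult mult_1 of_int_abs of_int_of_nat_eq abs_of_nat)
      ultimately have "1 / (cmod (t - of_int (e * int m)))\<^sup>2 \<le> 1 / (real m / 2)\<^sup>2"
        using \<open>m \<in> {0<..}\<close> by (intro divide_left_mono power_mono mult_pos_pos) auto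
      then show "norm ((?f \<circ> (\<lambda>m. e * int m)) m) \<le> 4 * (1 / (real m)\<^sup>2)"
        by (simp add: power_divide)
    qed
    moreover have "inj_on (\<lambda>m. e * int m) {0<..}" using e by (auto simp: inj_on_def)
    ultimately show ?thesis by (simp add: summable_on_reindex)
  qed
  from this[of 1] this[of "-1"]
  have "?f summable_on ({0} \<union> (\<lambda>m. 1 * int m) ` {0<..} \<union> (\<lambda>m. - 1 * int m) ` {0<..})"
    by (intro summable_on_union) auto
  moreover have "{0} \<union> (\<lambda>m. 1 * int m) ` {0<..} \<union> (\<lambda>m. - 1 * int m) ` {0<..} = UNIV"
  proof -
    have "n \<in> {0} \<union> (\<lambda>m. 1 * int m) ` {0<..} \<union> (\<lambda>m. - 1 * int m) ` {0<..}" for n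
    proof -
      consider "n = 0" | "n = 1 * int (nat n)" "nat n \<in> {0<..}"
        | "n = - 1 * int (nat (- n))" "nat (- n) \<in> {0<..}"
        by (cases n "0::int" rule: linorder_cases) auto
      then show ?thesis by cases (simp, blast, blast)
    qed
    then show ?thesis by blast
  qed
  ultimately show ?thesis by simp
qed

lemma Zc_electric_nonzero:
  assumes "t \<in> base"
  shows "t - of_int n \<noteq> 0"
  using cmod_minus_int_ge[OF assms, of n] assms by (cases "n = 0") (auto simp: base_def)

text \<open>The form \<open>A\<^sub>\<gamma>\<close> has a factor \<open>|Z\<^sub>\<gamma>|\<close> that cancels the pole of \<open>dZ\<^sub>\<gamma> / Z\<^sub>\<gamma>\<close>, so like \<open>V\<^sub>\<gamma>\<close> it is
  bounded by a multiple of \<open>|t - n|\<^sup>-\<^sup>2\<close>.\<close>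

lemma instanton_summable:
  assumes "t \<in> base"
  shows "(\<lambda>n. V_inst (- n, 1, 0) (t, \<theta>)) summable_on UNIV"
    and "(\<lambda>n. V_inst (n, - 1, 0) (t, \<theta>)) summable_on UNIV"
    and "(\<lambda>n. A_inst (- n, 1, 0) (t, \<theta>) X) summable_on UNIV"
    and "(\<lambda>n. A_inst (n, - 1, 0) (t, \<theta>) X) summable_on UNIV"
proof -
  have Z: "Zc t (- n, 1, 0) = t - of_int n" "Zc t (n, - 1, 0) = - (t - of_int n)" for n
    by (simp_all add: Zc_electric)
  have nz: "Zc t (- n, 1, 0) \<noteq> 0" "Zc t (n, - 1, 0) \<noteq> 0" for n
    unfolding Z using Zc_electric_nonzero[OF assms, of n] by auto
  have N: "cmod (Zc t (- n, 1, 0)) = cmod (t - of_int n)" "cmod (Zc t (n, - 1, 0)) = cmod (t - of_int n)" for n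
    unfolding Z by (simp_all only: norm_minus_cancel)
  have d: "cmod (dZ (t, \<theta>) (n, 1, 0) X) = cmod (dt X)" "cmod (dZ (t, \<theta>) (n, - 1, 0) X) = cmod (dt X)" for n
    by (simp_all add: dZ_def Zc'_electric norm_mult)
  have s: "(\<lambda>n. c * (sum_inverse_squares / (cmod (t - of_int n))\<^sup>2)) summable_on UNIV" for c
    using summable_on_cmult_right[OF summable_inverse_square_distances[OF assms], of "c * sum_inverse_squares"]
    by simp
  show "(\<lambda>n. V_inst (- n, 1, 0) (t, \<theta>)) summable_on UNIV"
    using V_inst_bound[OF nz(1)]
    by (intro summable_on_by_norm_comparison[OF s[of 1]]) (simp add: N)
  show "(\<lambda>n. V_inst (n, - 1, 0) (t, \<theta>)) summable_on UNIV"
    using V_inst_bound[OF nz(2)]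
    by (intro summable_on_by_norm_comparison[OF s[of 1]]) (simp add: N)
  show "(\<lambda>n. A_inst (- n, 1, 0) (t, \<theta>) X) summable_on UNIV"
    using A_inst_bound[OF nz(1), where X = X and \<theta> = \<theta>]
    by (intro summable_on_by_norm_comparison[OF s[of "cmod (dt X)"]])
      (simp only: N d)
  show "(\<lambda>n. A_inst (n, - 1, 0) (t, \<theta>) X) summable_on UNIV"
    using A_inst_bound[OF nz(2), where X = X and \<theta> = \<theta>]
    by (intro summable_on_by_norm_comparison[OF s[of "cmod (dt X)"]])
      (simp only: N d)
qed

lemma cis_mult_uminus: "cis_mult m (- a) = cnj (cis_mult m a)"
  by transfer (simp add: cis_cnj)

text \<open>Reversing the charge conjugates the phases \<open>e\<^sup>i\<^sup>m\<^sup>\<theta>\<close> and leaves \<open>dZ\<^sub>\<gamma> / Z\<^sub>\<gamma>\<close> unchanged; the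
  one-form \<open>dZ\<^sub>\<gamma> / Z\<^sub>\<gamma>\<close> minus its conjugate is purely imaginary, whence the sign for \<open>A\<close>.\<close>

lemma instanton_opposite_charge:
  assumes "Modules.additive \<theta>"
  shows "V_inst (n, - 1, 0) (t, \<theta>) = cnj (V_inst (- n, 1, 0) (t, \<theta>))"
    and "A_inst (n, - 1, 0) (t, \<theta>) X = - cnj (A_inst (- n, 1, 0) (t, \<theta>) X)"
proof -
  have \<theta>: "\<theta> (n, - 1, 0) = - \<theta> (- n, 1, 0)"
    using additive.minus[OF assms, of "(- n, 1, 0)"] by simp
  have Z: "Zc t (n, - 1, 0) = - Zc t (- n, 1, 0)" by (simp add: Zc_electric)
  have d: "dZ (t, \<theta>) (n, - 1, 0) X = - dZ (t, \<theta>) (- n, 1, 0) X"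
    by (simp add: dZ_def Zc'_electric)
  show "V_inst (n, - 1, 0) (t, \<theta>) = cnj (V_inst (- n, 1, 0) (t, \<theta>))"
    unfolding V_inst_def prod.case \<theta> Z
    by (simp add: cis_mult_uminus flip: infsum_cnj)
  show "A_inst (n, - 1, 0) (t, \<theta>) X = - cnj (A_inst (- n, 1, 0) (t, \<theta>) X)"
    unfolding A_inst_factored \<theta> Z d
    by (simp add: cis_mult_uminus algebra_simps flip: infsum_cnj)
qed

section \<open>Sums over the BPS charges\<close>

text \<open>The index is \<open>1\<close> on the charges \<open>\<plusminus>\<beta> + n\<delta>\<close>, and the only others that carry an index are the
  flavour charges \<open>n\<delta>\<close>. Summability of both halves is what allows the regrouping into pairs.\<close>

lemma bps_sum:
  fixes G :: "charge \<Rightarrow> complex"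
  assumes flavour: "\<And>n. G (n, 0, 0) = 0"
    and s: "(\<lambda>n. G (- n, 1, 0)) summable_on UNIV" "(\<lambda>n. G (n, - 1, 0)) summable_on UNIV"
  shows "(\<Sum>\<^sub>\<infinity>\<gamma>\<in>{\<gamma>. bps \<gamma> \<noteq> 0}. of_int (bps \<gamma>) * G \<gamma>) =
    (\<Sum>\<^sub>\<infinity>n\<in>UNIV. G (- n, 1, 0) + G (n, - 1, 0))"
proof -
  define p :: "int \<Rightarrow> charge" where "p = (\<lambda>n. (- n, 1, 0))"
  define m :: "int \<Rightarrow> charge" where "m = (\<lambda>n. (n, - 1, 0))"
  note p_m_def = p_def m_def
  have inj: "inj p" "inj m" by (auto simp: inj_def p_m_def)
  have one: "bps \<gamma> = 1" if "\<gamma> \<in> range p \<union> range m" for \<gamma>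
    using that by (auto simp: bps_def p_m_def)
  have zero: "G \<gamma> = 0" if \<gamma>: "bps \<gamma> \<noteq> 0" "\<gamma> \<notin> range p \<union> range m" for \<gamma>
  proof -
    obtain n k where nk: "\<gamma> = (n, k, 0)" "\<bar>k\<bar> = 1 \<or> k = 0"
      using \<gamma>(1) by (cases \<gamma>) (auto simp: bps_def split: if_splits)
    moreover have "k \<noteq> 1" "k \<noteq> - 1"
      using \<gamma>(2) nk rangeI[of p "- n"] rangeI[of m n] by (auto simp: p_m_def)
    ultimately have "\<gamma> = (n, 0, 0)" by auto
    then show ?thesis using flavour by simp
  qed
  have "(\<Sum>\<^sub>\<infinity>\<gamma>\<in>{\<gamma>. bps \<gamma> \<noteq> 0}. of_int (bps \<gamma>) * G \<gamma>) = infsum G (range p \<union> range m)"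
  proof (rule infsum_cong_neutral)
    fix \<gamma>
    show "G \<gamma> = 0" if "\<gamma> \<in> range p \<union> range m - {\<gamma>. bps \<gamma> \<noteq> 0}" using that one[of \<gamma>] by simp
    show "of_int (bps \<gamma>) * G \<gamma> = 0" if "\<gamma> \<in> {\<gamma>. bps \<gamma> \<noteq> 0} - (range p \<union> range m)"
      using that zero[of \<gamma>] by simp
    show "of_int (bps \<gamma>) * G \<gamma> = G \<gamma>" if "\<gamma> \<in> {\<gamma>. bps \<gamma> \<noteq> 0} \<inter> (range p \<union> range m)"
      using that one[of \<gamma>] by simp
  qed
  also have "\<dots> = infsum G (range p) + infsum G (range m)"
    using s inj by (intro infsum_Un_disjoint)
      (auto simp: summable_on_reindex o_def p_m_def)
  also have "\<dots> = (\<Sum>\<^sub>\<infinity>n\<in>UNIV. G (- n, 1, 0)) + (\<Sum>\<^sub>\<infinity>n\<in>UNIV. G (n, - 1, 0))"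
    using inj by (simp add: infsum_reindex o_def p_m_def)
  also have "\<dots> = (\<Sum>\<^sub>\<infinity>n\<in>UNIV. G (- n, 1, 0) + G (n, - 1, 0))"
    using s by (simp add: infsum_add)
  finally show ?thesis .
qed

definition V_total :: "point \<Rightarrow> complex" where
  "V_total p = (\<Sum>\<^sub>\<infinity>n\<in>UNIV. V_n n p)"

definition A_total :: "point \<Rightarrow> tangent \<Rightarrow> complex" where
  "A_total p X = (\<Sum>\<^sub>\<infinity>n\<in>UNIV. A_n n p X)"

lemma summable_V_n_A_n:
  assumes "t \<in> base"
  shows "(\<lambda>n. V_n n (t, \<theta>)) summable_on UNIV" "(\<lambda>n. A_n n (t, \<theta>) X) summable_on UNIV"
  unfolding V_n_def A_n_def diff_conv_add_uminus
  by (intro summable_on_add instanton_summable[OF assms] summable_on_uminus[THEN iffD2])+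

text \<open>In \<open>\<omega>\<^sub>1 + i\<omega>\<^sub>2\<close>, \<open>\<omega>\<^sub>3\<close> and \<open>T\<close> the summand of a charge \<open>\<gamma>\<close> is linear in \<open>V\<^sub>\<gamma>\<close> and \<open>A\<^sub>\<gamma>\<close>. Replacing \<open>\<gamma>\<close> by
  \<open>-\<gamma>\<close> preserves the coefficient of \<open>V\<^sub>\<gamma>\<close>, which is quadratic in \<open>dZ\<^sub>\<gamma>\<close> and \<open>d\<theta>\<^sub>\<gamma>\<close>, and reverses that of
  \<open>A\<^sub>\<gamma>\<close>, which is linear. This is why \<open>V\<^sub>n\<close> is a sum and \<open>A\<^sub>n\<close> a difference.\<close>

lemma bps_sum_linear:
  fixes c d e :: complex
  assumes t: "t \<in> base"
    and "\<And>n. G (n, 0, 0) = 0"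
    and p: "\<And>n. G (- n, 1, 0) = c * V_inst (- n, 1, 0) (t, \<theta>) +
      (d * A_inst (- n, 1, 0) (t, \<theta>) Y + e * A_inst (- n, 1, 0) (t, \<theta>) X)"
    and m: "\<And>n. G (n, - 1, 0) = c * V_inst (n, - 1, 0) (t, \<theta>) +
      (- d * A_inst (n, - 1, 0) (t, \<theta>) Y + - e * A_inst (n, - 1, 0) (t, \<theta>) X)"
  shows "(\<Sum>\<^sub>\<infinity>\<gamma>\<in>{\<gamma>. bps \<gamma> \<noteq> 0}. of_int (bps \<gamma>) * G \<gamma>) =
    c * V_total (t, \<theta>) + (d * A_total (t, \<theta>) Y + e * A_total (t, \<theta>) X)"
proof -
  have "(\<lambda>n. G (- n, 1, 0)) summable_on UNIV" "(\<lambda>n. G (n, - 1, 0)) summable_on UNIV"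
    unfolding p m by (intro summable_on_add summable_on_cmult_right instanton_summable[OF t])+
  then have "(\<Sum>\<^sub>\<infinity>\<gamma>\<in>{\<gamma>. bps \<gamma> \<noteq> 0}. of_int (bps \<gamma>) * G \<gamma>) =
      (\<Sum>\<^sub>\<infinity>n\<in>UNIV. G (- n, 1, 0) + G (n, - 1, 0))"
    by (intro bps_sum assms(2))
  also have "\<dots> = (\<Sum>\<^sub>\<infinity>n\<in>UNIV. c * V_n n (t, \<theta>) + (d * A_n n (t, \<theta>) Y + e * A_n n (t, \<theta>) X))"
    by (intro infsum_cong) (simp add: p m V_n_def A_n_def algebra_simps)
  also have "\<dots> = c * V_total (t, \<theta>) + (d * A_total (t, \<theta>) Y + e * A_total (t, \<theta>) X)"
    unfolding V_total_def A_total_def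
    by (simp add: infsum_add infsum_cmult_right' summable_on_add summable_on_cmult_right
        summable_V_n_A_n[OF t])
  finally show ?thesis .
qed

lemma V_total_A_total_real:
  assumes "Modules.additive \<theta>"
  shows "cnj (V_total (t, \<theta>)) = V_total (t, \<theta>)" "cnj (A_total (t, \<theta>) X) = A_total (t, \<theta>) X"
  by (simp_all add: V_total_def A_total_def V_n_def A_n_def instanton_opposite_charge[OF assms] add.commute
      flip: infsum_cnj)

section \<open>The three forms in terms of one connection form\<close>

text \<open>The one-form \<open>W\<close> of the explicit metric, written in the frame \<open>\<beta>\<^sup>\<or>\<close> at the given point, and the
  coefficient \<open>F\<close> of \<open>|dt|\<^sup>2\<close>. Together they have the shape of a Gibbons--Hawking ansatz: \<open>Re W\<close> is a
  connection form and \<open>F\<close> the associated potential.\<close>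

definition connection_form :: "point \<Rightarrow> tangent \<Rightarrow> complex" where
  "connection_form p X = d\<theta> (0, 0, 1) X - Zc' (fst p) (0, 0, 1) * d\<theta> (0, 1, 0) X +
     2 * pi * A_total p X - \<i> * V_total p * d\<theta> (0, 1, 0) X"

definition potential :: "point \<Rightarrow> real" where
  "potential p = Im (Zc' (fst p) (0, 0, 1)) + Re (V_total p)"

lemma omega12_eq:
  assumes "t \<in> base"
  shows "omega12 (t, \<theta>) X Y = 1 / (2 * pi) * wedge dt (connection_form (t, \<theta>)) X Y"
proof -
  have "(\<Sum>\<^sub>\<infinity>\<gamma>\<in>{\<gamma>. bps \<gamma> \<noteq> 0}. of_int (bps \<gamma>) *
        (wedge (dZ (t, \<theta>) \<gamma>) (A_inst \<gamma> (t, \<theta>)) X Y +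
         \<i> / (2 * pi) * V_inst \<gamma> (t, \<theta>) * wedge (\<lambda>X. of_real (d\<theta> \<gamma> X)) (dZ (t, \<theta>) \<gamma>) X Y)) =
     \<i> / (2 * pi) * (d\<theta> (0, 1, 0) X * dt Y - d\<theta> (0, 1, 0) Y * dt X) * V_total (t, \<theta>) +
     (dt X * A_total (t, \<theta>) Y + - dt Y * A_total (t, \<theta>) X)"
    by (rule bps_sum_linear[OF assms])
       (auto simp: wedge_def dZ_def Zc'_electric d\<theta>_def algebra_simps A_inst_def split: prod.splits)
  then show ?thesis
    unfolding omega12_def
    by (simp add: pair_wedge_def wedge_def dZ_def Zc'_electric connection_form_def field_simps)
qed

text \<open>All instanton corrections are real. Hence \<open>Im W = -F d\<theta>\<^sub>\<beta>\<close>, and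
  \<open>i/2 W \<and> W\<^sup>* = Re W \<and> Im W\<close> equals \<open>F d\<theta>\<^sub>\<beta> \<and> (d\<theta>\<^sub>\<beta>\<^sub>\<or> + 2\<pi>A)\<close>, in which the term \<open>Re \<tau> d\<theta>\<^sub>\<beta>\<close> of \<open>Re W\<close> has
  dropped out. Divided by \<open>4\<pi>\<^sup>2 F\<close>, this is the part of \<open>\<omega>\<^sub>3\<close> that involves the fibre coordinates.\<close>

lemma omega3_eq:
  assumes t: "t \<in> base" and \<theta>: "Modules.additive \<theta>" and nz: "potential (t, \<theta>) \<noteq> 0"
  shows "omega3 (t, \<theta>) X Y = Re (\<i> / 2 * (of_real (potential (t, \<theta>)) * wedge dt (\<lambda>X. cnj (dt X)) X Y +
    of_real (1 / (4 * pi\<^sup>2) * inverse (potential (t, \<theta>))) * wedge (connection_form (t, \<theta>)) (\<lambda>X. cnj (connection_form (t, \<theta>) X)) X Y))"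
proof -
  define V where "V = Re (V_total (t, \<theta>))"
  define A where "A X = Re (A_total (t, \<theta>) X)" for X
  have V: "V_total (t, \<theta>) = of_real V" and A: "A_total (t, \<theta>) X = of_real (A X)" for X
    using V_total_A_total_real[OF \<theta>] by (simp_all add: V_def A_def complex_eq_iff)
  define \<tau> where "\<tau> = Zc' t (0, 0, 1)"
  define F where "F = potential (t, \<theta>)"
  have F: "F = Im \<tau> + V" by (simp add: F_def potential_def \<tau>_def V_def)
  define x y where "x X = d\<theta> (0, 1, 0) X" and "y X = d\<theta> (0, 0, 1) X" for X
  have "(\<Sum>\<^sub>\<infinity>\<gamma>\<in>{\<gamma>. bps \<gamma> \<noteq> 0}. of_int (bps \<gamma>) *
        (\<i> / 2 * V_inst \<gamma> (t, \<theta>) * wedge (dZ (t, \<theta>) \<gamma>) (\<lambda>X. cnj (dZ (t, \<theta>) \<gamma> X)) X Y +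
         1 / (2 * pi) * wedge (\<lambda>X. of_real (d\<theta> \<gamma> X)) (A_inst \<gamma> (t, \<theta>)) X Y)) =
     \<i> / 2 * wedge dt (\<lambda>X. cnj (dt X)) X Y * V_total (t, \<theta>) +
     (1 / (2 * pi) * d\<theta> (0, 1, 0) X * A_total (t, \<theta>) Y +
      - (1 / (2 * pi) * d\<theta> (0, 1, 0) Y) * A_total (t, \<theta>) X)"
    by (rule bps_sum_linear[OF t])
       (auto simp: wedge_def dZ_def Zc'_electric d\<theta>_def field_simps A_inst_def split: prod.splits)
  moreover have "Re (\<i> / 2 * wedge dt (\<lambda>X. cnj (dt X)) X Y * V_total (t, \<theta>) +
     (1 / (2 * pi) * d\<theta> (0, 1, 0) X * A_total (t, \<theta>) Y +
      - (1 / (2 * pi) * d\<theta> (0, 1, 0) Y) * A_total (t, \<theta>) X)) =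
    - V * Im (dt X * cnj (dt Y)) + 1 / (2 * pi) * (x X * A Y - x Y * A X)"
    by (simp add: wedge_def V A x_def field_simps)
  moreover have "Re (1 / 4 * pair_wedge (dZ (t, \<theta>)) (\<lambda>\<gamma> X. cnj (dZ (t, \<theta>) \<gamma> X)) X Y) =
      - Im \<tau> * Im (dt X * cnj (dt Y))"
    by (simp add: pair_wedge_def wedge_def dZ_def Zc'_electric \<tau>_def algebra_simps)
  moreover have "Re (1 / (8 * pi\<^sup>2) *
      pair_wedge (\<lambda>\<gamma> X. of_real (d\<theta> \<gamma> X)) (\<lambda>\<gamma> X. of_real (d\<theta> \<gamma> X)) X Y) =
      1 / (8 * pi\<^sup>2) * (2 * (y X * x Y - y Y * x X))"
  proof -
    have "pair_wedge (\<lambda>\<gamma> X. of_real (d\<theta> \<gamma> X)) (\<lambda>\<gamma> X. of_real (d\<theta> \<gamma> X)) X Y =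
        of_real (2 * (y X * x Y - y Y * x X))"
      by (simp add: pair_wedge_def wedge_def x_def y_def algebra_simps)
    moreover have "1 / (8 * (complex_of_real pi)\<^sup>2) = of_real (1 / (8 * pi\<^sup>2))" by simp
    ultimately show ?thesis by (simp only: flip: of_real_mult) simp
  qed
  ultimately have "omega3 (t, \<theta>) X Y = - Im \<tau> * Im (dt X * cnj (dt Y)) -
      1 / (8 * pi\<^sup>2) * (2 * (y X * x Y - y Y * x X)) +
      (- V * Im (dt X * cnj (dt Y)) + 1 / (2 * pi) * (x X * A Y - x Y * A X))"
    unfolding omega3_def by (simp only: plus_complex.sel minus_complex.sel)
  also have "\<dots> = - F * Im (dt X * cnj (dt Y)) +
      1 / (4 * pi\<^sup>2) * (x X * (y Y + 2 * pi * A Y) - x Y * (y X + 2 * pi * A X))"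
    by (simp add: F field_simps power2_eq_square)
  finally have e0: "omega3 (t, \<theta>) X Y = - F * Im (dt X * cnj (dt Y)) +
      1 / (4 * pi\<^sup>2) * (x X * (y Y + 2 * pi * A Y) - x Y * (y X + 2 * pi * A X))" .
  have e1: "Re (\<i> / 2 * (of_real F * wedge dt (\<lambda>X. cnj (dt X)) X Y)) = - F * Im (dt X * cnj (dt Y))"
    by (simp add: wedge_def field_simps)
  have e2: "Re (\<i> / 2 * wedge (connection_form (t, \<theta>)) (\<lambda>X. cnj (connection_form (t, \<theta>) X)) X Y) =
      F * (x X * (y Y + 2 * pi * A Y) - x Y * (y X + 2 * pi * A X))"
    by (simp add: wedge_def connection_form_def V A F x_def[symmetric] y_def[symmetric] \<tau>_def[symmetric] algebra_simps)
  have e3: "Re (\<i> / 2 * (of_real F * u + of_real c * w)) =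
      Re (\<i> / 2 * (of_real F * u)) + c * Re (\<i> / 2 * w)" for u w :: complex and c
    by (simp add: field_simps)
  show ?thesis
    unfolding F_def[symmetric] e0 e3 e1 e2 using nz by (simp add: F_def[symmetric])
qed

lemma T_tensor_eq:
  assumes "t \<in> base"
  shows "T_tensor (t, \<theta>) X Y = potential (t, \<theta>) * abs_sq dt X Y"
proof -
  have "(\<Sum>\<^sub>\<infinity>\<gamma>\<in>{\<gamma>. bps \<gamma> \<noteq> 0}. of_int (bps \<gamma>) * (V_inst \<gamma> (t, \<theta>) * abs_sq (dZ (t, \<theta>) \<gamma>) X Y)) =
     abs_sq dt X Y * V_total (t, \<theta>) + (0 * A_total (t, \<theta>) Y + 0 * A_total (t, \<theta>) X)"
    by (rule bps_sum_linear[OF assms])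
       (auto simp: abs_sq_def dZ_def Zc'_electric algebra_simps)
  then show ?thesis
    by (simp add: T_tensor_def tau_def Zc'_electric potential_def mult.assoc algebra_simps)
qed

lemma potential_nonzero:
  assumes "(t, \<theta>) \<in> N_space \<theta>f"
  shows "potential (t, \<theta>) \<noteq> 0"
proof
  assume "potential (t, \<theta>) = 0"
  moreover have "t \<in> base" using assms by (simp add: N_space_def torus_bundle_def)
  ultimately have "T_tensor (t, \<theta>) X Y = 0" for X Y by (simp add: T_tensor_eq)
  then have "dt (1, 0, 0) = 0"
    using assms unfolding N_space_def horizontally_nondegenerate_def by blast
  then show False by (simp add: dt_def)
qed

text \<open>The instanton form \<open>A\<close> depends on a vector through \<open>dt\<close> alone. Once \<open>dt\<close> is prescribed, \<open>Im W = -F d\<theta>\<^sub>\<beta>\<close>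
  fixes \<open>d\<theta>\<^sub>\<beta>\<close> because \<open>F \<noteq> 0\<close>, and \<open>Re W\<close> fixes \<open>d\<theta>\<^sub>\<beta>\<^sub>\<or>\<close>.\<close>

lemma dt_connection_form_onto:
  assumes "Modules.additive \<theta>" "potential (t, \<theta>) \<noteq> 0"
  shows "\<exists>Y. dt Y = u \<and> connection_form (t, \<theta>) Y = v"
proof -
  define V where "V = Re (V_total (t, \<theta>))"
  define A where "A = Re (A_total (t, \<theta>) (u, 0, 0))"
  have V: "V_total (t, \<theta>) = of_real V"
    using V_total_A_total_real(1)[OF assms(1)] by (simp add: V_def complex_eq_iff)
  have A: "A_total (t, \<theta>) (u, a, b) = of_real A" for a b
  proof -
    have "A_total (t, \<theta>) (u, a, b) = A_total (t, \<theta>) (u, 0, 0)"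
      by (simp add: A_total_def A_n_def A_inst_def dZ_def dt_def)
    then show ?thesis
      using V_total_A_total_real(2)[OF assms(1)] by (simp add: A_def complex_eq_iff)
  qed
  define \<tau> where "\<tau> = Zc' t (0, 0, 1)"
  define a where "a = - Im v / potential (t, \<theta>)"
  have "potential (t, \<theta>) * a = - Im v" using assms(2) by (simp add: a_def)
  then have a: "(Im \<tau> + V) * a = - Im v" by (simp add: potential_def \<tau>_def V_def)
  have "connection_form (t, \<theta>) (u, a, Re v - 2 * pi * A + Re \<tau> * a) = v"
    using a by (simp add: connection_form_def d\<theta>_def V A \<tau>_def[symmetric] complex_eq_iff algebra_simps)
  then show ?thesis by (intro exI conjI) (auto simp: dt_def)
qed

section \<open>The metric\<close>

text \<open>Evaluating \<open>\<omega>\<^sub>1(I\<^sub>2 X, Y) = \<omega>\<^sub>3(X, Y)\<close> on vectors \<open>Y\<close> with prescribed values of \<open>(a, b)\<close> shows that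
  \<open>I\<^sub>2\<close> maps \<open>(a, b)\<close> to \<open>(-iE b\<^sup>*, iF a\<^sup>*)\<close>, and then \<open>g(X, Y) = \<omega>\<^sub>2(X, I\<^sub>2 Y)\<close> can be read off.\<close>

lemma metric_from_holomorphic_symplectic_pair:
  fixes a b :: "'v \<Rightarrow> complex" and g :: "'v \<Rightarrow> 'v \<Rightarrow> real" and F E :: real
  assumes onto: "\<And>u v. \<exists>Y. a Y = u \<and> b Y = v"
    and I: "\<And>X. I1 (I2 X) = I3 X" "\<And>X Y. g (I2 X) (I2 Y) = g X Y"
    and w1: "\<And>X Y. g (I1 X) Y = Re (a X * b Y - a Y * b X)"
    and w2: "\<And>X Y. g (I2 X) Y = Im (a X * b Y - a Y * b X)"
    and w3: "\<And>X Y. g (I3 X) Y = Re (\<i> / 2 * (of_real F * (a X * cnj (a Y) - a Y * cnj (a X)) +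
      of_real E * (b X * cnj (b Y) - b Y * cnj (b X))))"
  shows "g X Y = F * Re (a X * cnj (a Y)) + E * Re (b X * cnj (b Y))"
proof -
  have key: "Re (a (I2 X) * b Y - a Y * b (I2 X)) =
      - F * Im (a X * cnj (a Y)) - E * Im (b X * cnj (b Y))" for X Y
    using w1[of "I2 X" Y] w3[of X Y] by (simp add: I field_simps)
  have a: "a (I2 X) = - \<i> * E * cnj (b X)" for X
  proof -
    obtain Y Y' where "a Y = 0" "b Y = 1" "a Y' = 0" "b Y' = \<i>" using onto by metis
    then show ?thesis using key[of X Y] key[of X Y'] by (simp add: complex_eq_iff)
  qed
  have b: "b (I2 X) = \<i> * F * cnj (a X)" for X
  proof -
    obtain Y Y' where "a Y = 1" "b Y = 0" "a Y' = \<i>" "b Y' = 0" using onto by metis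
    then show ?thesis using key[of X Y] key[of X Y'] by (simp add: complex_eq_iff)
  qed
  have "g X Y = Im (a X * b (I2 Y) - a (I2 Y) * b X)"
    using w2[of X "I2 Y"] I(2)[of X Y] by simp
  then show ?thesis by (simp add: a b algebra_simps)
qed

lemma instanton_metric:
  assumes "instanton_corrected_hyperkaehler \<theta>f g I1 I2 I3" and N: "(t, \<theta>) \<in> N_space \<theta>f"
  shows "g (t, \<theta>) X Y = potential (t, \<theta>) * abs_sq dt X Y +
    1 / (4 * pi\<^sup>2) * inverse (potential (t, \<theta>)) * abs_sq (connection_form (t, \<theta>)) X Y"
proof -
  have t: "t \<in> base" and \<theta>: "Modules.additive \<theta>"
    using N by (auto simp: N_space_def torus_bundle_def)
  note nz = potential_nonzero[OF N]
  define b where "b X = 1 / (2 * pi) * connection_form (t, \<theta>) X" for X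
  have hk: "hyperkaehler \<theta>f (N_space \<theta>f) g I1 I2 I3"
    and "\<forall>p\<in>N_space \<theta>f. \<forall>X Y. omega1 p X Y = g p (I1 p X) Y \<and>
        omega2 p X Y = g p (I2 p X) Y \<and> omega3 p X Y = g p (I3 p X) Y"
    using assms(1) by (simp_all add: instanton_corrected_hyperkaehler_def)
  then have w: "omega1 (t, \<theta>) X Y = g (t, \<theta>) (I1 (t, \<theta>) X) Y"
    "omega2 (t, \<theta>) X Y = g (t, \<theta>) (I2 (t, \<theta>) X) Y"
    "omega3 (t, \<theta>) X Y = g (t, \<theta>) (I3 (t, \<theta>) X) Y" for X Y
    using N by blast+
  have "pseudo_kaehler \<theta>f (N_space \<theta>f) g I2" using hk by (simp add: hyperkaehler_def)
  then have I2: "g (t, \<theta>) (I2 (t, \<theta>) X) (I2 (t, \<theta>) Y) = g (t, \<theta>) X Y" for X Y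
    using N unfolding pseudo_kaehler_def by blast
  have I3: "I1 (t, \<theta>) (I2 (t, \<theta>) X) = I3 (t, \<theta>) X" for X
    using hk N unfolding hyperkaehler_def by blast
  have "g (t, \<theta>) X Y = potential (t, \<theta>) * Re (dt X * cnj (dt Y)) + inverse (potential (t, \<theta>)) * Re (b X * cnj (b Y))"
  proof (rule metric_from_holomorphic_symplectic_pair[where a = dt and b = b])
    fix X Y
    have e: "dt X * b Y - dt Y * b X = omega12 (t, \<theta>) X Y"
      by (simp add: omega12_eq[OF t] wedge_def b_def algebra_simps)
    show "g (t, \<theta>) (I1 (t, \<theta>) X) Y = Re (dt X * b Y - dt Y * b X)"
      unfolding e w(1)[symmetric] omega1_def ..
    show "g (t, \<theta>) (I2 (t, \<theta>) X) Y = Im (dt X * b Y - dt Y * b X)"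
      unfolding e w(2)[symmetric] omega2_def ..
    have "b X * cnj (b Y) - b Y * cnj (b X) =
        1 / (4 * pi\<^sup>2) * wedge (connection_form (t, \<theta>)) (\<lambda>X. cnj (connection_form (t, \<theta>) X)) X Y"
      by (simp add: wedge_def b_def field_simps power2_eq_square)
    then show "g (t, \<theta>) (I3 (t, \<theta>) X) Y = Re (\<i> / 2 *
      (of_real (potential (t, \<theta>)) * (dt X * cnj (dt Y) - dt Y * cnj (dt X)) +
       of_real (inverse (potential (t, \<theta>))) * (b X * cnj (b Y) - b Y * cnj (b X))))"
      unfolding w(3)[symmetric] omega3_eq[OF t \<theta> nz] by (simp add: wedge_def mult_ac)
  next
    fix u v :: complex
    obtain Y where "dt Y = u" "connection_form (t, \<theta>) Y = 2 * pi * v"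
      using dt_connection_form_onto[OF \<theta> nz] by blast
    then show "\<exists>Y. dt Y = u \<and> b Y = v" by (intro exI[of _ Y]) (simp add: b_def)
  qed (rule I3 I2)+
  then show ?thesis
    by (simp add: abs_sq_def b_def power2_eq_square field_simps)
qed

text \<open>The frame \<open>\<beta>\<^sup>\<or> + k\<beta>\<close> adds \<open>k d\<theta>\<^sub>\<beta>\<close> to the first term of \<open>W\<close>, and the continued logarithm subtracts
  it again in the second. The logarithmic term of \<open>F\<close> is \<open>Im \<tau>\<close>.\<close>

theorem corollary23:
  fixes \<theta>f :: "int \<Rightarrow> angle"
    and g :: "point \<Rightarrow> tangent \<Rightarrow> tangent \<Rightarrow> real"
    and I1 I2 I3 :: "point \<Rightarrow> tangent \<Rightarrow> tangent"
    and U :: "complex set" and k :: "complex \<Rightarrow> int" and L :: "complex \<Rightarrow> complex"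
    and t :: complex and \<theta> :: "charge \<Rightarrow> angle"
    and X Y :: tangent
  assumes "Modules.additive \<theta>f"
    and "instanton_corrected_hyperkaehler \<theta>f g I1 I2 I3"
    and "local_frame U k L"
    and "(t, \<theta>) \<in> N_space \<theta>f" and "t \<in> U"
  shows "complex_of_real (g (t, \<theta>) X Y) =
    (let q = exp (2 * pi * \<i> * t);
         F = complex_of_real (- 1 / (2 * pi) * ln (cmod ((1 - q) / q))) +
             (\<Sum>\<^sub>\<infinity>n\<in>UNIV. V_n n (t, \<theta>));
         W = (\<lambda>X. complex_of_real (d\<theta> (0, k t, 1) X)
               - 1 / (2 * pi * \<i>) * (L t - Ln q) * complex_of_real (d\<theta> (0, 1, 0) X)
               + (\<Sum>\<^sub>\<infinity>n\<in>UNIV. 2 * pi * A_n n (t, \<theta>) X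
                     - \<i> * V_n n (t, \<theta>) * complex_of_real (d\<theta> (0, 1, 0) X)))
     in F * complex_of_real (abs_sq dt X Y)
        + 1 / (4 * pi\<^sup>2) * inverse F * complex_of_real (abs_sq W X Y))"
proof -
  have t: "t \<in> base" and \<theta>: "Modules.additive \<theta>"
    using assms(4) by (auto simp: N_space_def torus_bundle_def)
  define q where "q = exp (2 * pi * \<i> * t)"
  have q: "1 - q \<noteq> 0" "q \<noteq> 0" using exp_on_base(2)[OF t] by (auto simp: q_def)
  have "Im (Zc' t (0, 0, 1)) = - 1 / (2 * pi) * (Re (Ln (1 - q)) - Re (Ln q))"
  proof -
    have "1 / (2 * pi * \<i>) * w = of_real (1 / (2 * pi)) * (- \<i> * w)" for w
      by (simp add: field_simps)
    then show ?thesis unfolding Zc'_magnetic[OF t] q_def[symmetric] by simp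
  qed
  also have "Re (Ln (1 - q)) - Re (Ln q) = ln (cmod ((1 - q) / q))"
    using q by (simp add: norm_divide ln_div)
  finally have F: "complex_of_real (potential (t, \<theta>)) =
      complex_of_real (- 1 / (2 * pi) * ln (cmod ((1 - q) / q))) + (\<Sum>\<^sub>\<infinity>n\<in>UNIV. V_n n (t, \<theta>))"
    using V_total_A_total_real(1)[OF \<theta>, of t]
    by (simp add: potential_def complex_eq_iff flip: V_total_def)
  have L: "L t - Ln q = 2 * pi * \<i> * (Zc' t (0, 0, 1) + of_int (k t))"
    using local_frame_log[OF assms(3,5)] by (simp add: Zc'_magnetic[OF t] q_def field_simps)
  have W: "connection_form (t, \<theta>) = (\<lambda>X. complex_of_real (d\<theta> (0, k t, 1) X)
      - 1 / (2 * pi * \<i>) * (L t - Ln q) * complex_of_real (d\<theta> (0, 1, 0) X)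
      + (\<Sum>\<^sub>\<infinity>n\<in>UNIV. 2 * pi * A_n n (t, \<theta>) X
            - \<i> * V_n n (t, \<theta>) * complex_of_real (d\<theta> (0, 1, 0) X)))"
  proof
    fix X
    define x where "x = complex_of_real (d\<theta> (0, 1, 0) X)"
    have "(\<Sum>\<^sub>\<infinity>n\<in>UNIV. 2 * pi * A_n n (t, \<theta>) X - \<i> * V_n n (t, \<theta>) * x) =
        (\<Sum>\<^sub>\<infinity>n\<in>UNIV. 2 * pi * A_n n (t, \<theta>) X + (- \<i> * x) * V_n n (t, \<theta>))"
      by (simp add: algebra_simps)
    also have "\<dots> = 2 * pi * A_total (t, \<theta>) X + (- \<i> * x) * V_total (t, \<theta>)"
      unfolding A_total_def V_total_def
      by (simp only: infsum_add infsum_cmult_right' summable_on_cmult_right summable_V_n_A_n[OF t])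
    finally have sum: "(\<Sum>\<^sub>\<infinity>n\<in>UNIV. 2 * pi * A_n n (t, \<theta>) X - \<i> * V_n n (t, \<theta>) * x) =
        2 * pi * A_total (t, \<theta>) X + (- \<i> * x) * V_total (t, \<theta>)" .
    have "complex_of_real (d\<theta> (0, k t, 1) X) = d\<theta> (0, 0, 1) X + of_int (k t) * x"
      by (simp add: d\<theta>_def x_def split: prod.splits)
    moreover have "1 / (2 * pi * \<i>) * (L t - Ln q) = Zc' t (0, 0, 1) + of_int (k t)"
      unfolding L by simp
    ultimately show "connection_form (t, \<theta>) X = complex_of_real (d\<theta> (0, k t, 1) X)
      - 1 / (2 * pi * \<i>) * (L t - Ln q) * complex_of_real (d\<theta> (0, 1, 0) X)
      + (\<Sum>\<^sub>\<infinity>n\<in>UNIV. 2 * pi * A_n n (t, \<theta>) X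
            - \<i> * V_n n (t, \<theta>) * complex_of_real (d\<theta> (0, 1, 0) X))"
      unfolding x_def[symmetric] sum by (simp add: connection_form_def x_def algebra_simps)
  qed
  show ?thesis
    unfolding Let_def q_def[symmetric] F[symmetric] W[symmetric]
    by (simp add: instanton_metric[OF assms(2,4)])
qed

end
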